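(* Let $\zeta$ be the Riemann zeta function, let $\xi$ be the entire function $\xi(z):=\frac12 z(1-z)\pi^{-z/2}\Gamma\!\left(\frac z2\right)\zeta(z)$, and let $\nu_\xi:\mathbb{C}\to\widehat{\mathbb{C}}$ be the meromorphic function $\nu_\xi(z):=z-\dfrac{\xi(z)}{z\,\xi'(z)}$. The following conditions are equivalent: (a') The Riemann hypothesis holds (every non-trivial zero of $\zeta$ lies on the line $\{s\in\mathbb{C}:\operatorname{Re}s=1/2\}$) and all zeros of $\zeta$ are simple. (b') All the fixed points of $\nu_\xi$ are indifferent. (c') The function $\nu_\xi$ has no attracting fixed point. (d') There is no topological disk $D\subset\mathbb{C}$ with $\overline{\nu_\xi(D)}\subset D$.
   Context: $\widehat{\mathbb{C}}=\mathbb{C}\cup\{\infty\}$ is the Riemann sphere; a meromorphic function on $\mathbb{C}$ is regarded as a holomorphic map $\mathbb{C}\to\widehat{\mathbb{C}}$, with removable singularities filled in (both in $\xi$ and in $\nu_\xi$). The Riemann zeta function $\zeta$ is the meromorphic continuation to $\mathbb{C}$ of $\sum_{n\ge1}n^{-s}$ ($\operatorname{Re}s>1$). Its trivial zeros are $-2,-4,-6,\dots$; all other zeros are called non-trivial. For a meromorphic function $f$ on $\mathbb{C}$, a point $\alpha\in\mathbb{C}$ with $f(\alpha)=\alpha$ is a fixed point, with multiplier $f'(\alpha)$; it is attracting if $|f'(\alpha)|<1$, indifferent if $|f'(\alpha)|=1$, and repelling if $|f'(\alpha)|>1$. A topological disk is an open subset of $\mathbb{C}$ homeomorphic to the open unit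 disk; the closure $\overline{\nu_\xi(D)}$ is taken in $\widehat{\mathbb{C}}$. *)

theory Defs
  imports "HOL-Complex_Analysis.Complex_Analysis"
begin

text \<open>
  The meromorphic continuation of the Dirichlet series. A function that is
  \<open>nicely_meromorphic_on\<close> the plane is continuous except at its poles and takes the value 0 at
  its poles, so by the identity theorem the description determines at most one function.
  In particular \<open>zeta 1 = 0\<close> is only a convention for the pole.
\<close>

definition zeta :: "complex \<Rightarrow> complex" where
  "zeta = (THE f. f nicely_meromorphic_on UNIV \<and>
                  (\<forall>s. Re s > 1 \<longrightarrow> (\<lambda>n. 1 / of_nat (Suc n) powr s) sums f s))"

text \<open>The pole has to be excluded here because of that convention.\<close>

definition zeta_zeros :: "complex set" where
  "zeta_zeros = {s. \<not> is_pole zeta s \<and> zeta s = 0}"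

definition zeta_trivial_zeros :: "complex set" where
  "zeta_trivial_zeros = {- 2 * of_nat n | n. n \<ge> 1}"

definition Riemann_hypothesis :: bool where
  "Riemann_hypothesis \<longleftrightarrow> (\<forall>s \<in> zeta_zeros - zeta_trivial_zeros. Re s = 1 / 2)"

text \<open>
  The singularities of the product at \<open>0\<close>, \<open>1\<close> and the trivial zeros are
  removable; \<open>remove_sings\<close> replaces the values there by the limits.
\<close>

definition xi :: "complex \<Rightarrow> complex" where
  "xi = remove_sings (\<lambda>z. 1 / 2 * z * (1 - z) * of_real pi powr (- z / 2) * Gamma (z / 2) * zeta z)"

text \<open>The Riemann sphere: \<open>None\<close> is the point at infinity.\<close>

definition riemann_sphere :: "complex option topology" where
  "riemann_sphere = Alexandroff_compactification euclidean"

text \<open>A meromorphic function as a map into the sphere, with removable singularities filled in.\<close>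

definition sphere_map :: "(complex \<Rightarrow> complex) \<Rightarrow> complex \<Rightarrow> complex option" where
  "sphere_map f z = (if is_pole f z then None else Some (remove_sings f z))"

definition nu_xi :: "complex \<Rightarrow> complex option" where
  "nu_xi = sphere_map (\<lambda>z. z - xi z / (z * deriv xi z))"

definition fixed_point :: "(complex \<Rightarrow> complex option) \<Rightarrow> complex \<Rightarrow> bool" where
  "fixed_point g \<alpha> \<longleftrightarrow> g \<alpha> = Some \<alpha>"

text \<open>
  For a holomorphic map \<open>g\<close> into the sphere, \<open>g\<close> is finite near a point with finite
  value, so the derivative there does not depend on the value of \<open>the None\<close>.
\<close>

definition multiplier :: "(complex \<Rightarrow> complex option) \<Rightarrow> complex \<Rightarrow> complex" where
  "multiplier g \<alpha> = deriv (\<lambda>z. the (g z)) \<alpha>"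

definition attracting :: "(complex \<Rightarrow> complex option) \<Rightarrow> complex \<Rightarrow> bool" where
  "attracting g \<alpha> \<longleftrightarrow> fixed_point g \<alpha> \<and> norm (multiplier g \<alpha>) < 1"

definition indifferent :: "(complex \<Rightarrow> complex option) \<Rightarrow> complex \<Rightarrow> bool" where
  "indifferent g \<alpha> \<longleftrightarrow> fixed_point g \<alpha> \<and> norm (multiplier g \<alpha>) = 1"

definition topological_disk :: "complex set \<Rightarrow> bool" where
  "topological_disk D \<longleftrightarrow> open D \<and> D homeomorphic (ball 0 1 :: complex set)"

end

theory Submission
  imports Defs "HOL-Real_Asymp.Real_Asymp"
begin

text \<open>
  The fixed points of \<open>nu_xi\<close> are the zeros \<open>\<alpha>\<close> of \<open>xi\<close>. If \<open>\<alpha>\<close> has order \<open>m\<close>, its multiplier is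
  \<open>1 - 1 / (m \<alpha>)\<close>, so it is attracting, indifferent or repelling according as \<open>m Re \<alpha>\<close> is greater
  than, equal to or less than \<open>1 / 2\<close>. The functional equation \<open>xi (1 - z) = xi z\<close> preserves orders; so if
  there is no attracting fixed point, adding \<open>m Re \<alpha> \<le> 1 / 2\<close> and \<open>m Re (1 - \<alpha>) \<le> 1 / 2\<close> gives
  \<open>m \<le> 1\<close>, whence \<open>m = 1\<close> and \<open>Re \<alpha> = 1 / 2\<close>. The zeros of \<open>xi\<close> are the non-trivial zeros of \<open>zeta\<close>, with
  the same orders, and the trivial zeros are simple because \<open>zeta (1 + 2 n) \<noteq> 0\<close>.

  A small disk around an attracting fixed point is mapped well into itself. Conversely, a
  disk with \<open>closure (nu_xi D) \<subseteq> D\<close> avoids the pole \<open>0\<close> of \<open>nu_xi\<close>, so it is conformally the unit disk,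
  and there Brouwer's theorem and the Schwarz lemma provide an attracting fixed point.

  The continuation and the functional equation of \<open>zeta\<close> are obtained by Riemann's method, from
  the inversion formula of the theta function.
\<close>

section \<open>The inversion formula of the theta function\<close>

text \<open>The factor \<open>z\<close> in the denominator of \<open>nu_xi\<close> ties the dynamics
  to the critical line. Plain Newton iteration has multiplier \<open>1 - 1 / m\<close> at a zero of
  order \<open>m\<close>, wherever that zero lies. With the damping, the position enters through
  \<open>w \<mapsto> 1 - 1 / w\<close>, which carries the half-plane \<open>Re w > 1 / 2\<close>
  onto the open unit disk. A multiple zero on the critical line becomes attracting, and so does at
  least one of two mirror zeros off the line; this is why location and simplicity are controlled
  together. Taking the closure in the sphere is essential in (d'): a closed set that misses infinity
  is compact, and compactness inside the disk is what excludes multipliers of modulus one. The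
  description of \<open>zeta\<close> determines a function only once some function is known to
  satisfy it. Hence an explicit entire function \<open>riemann_xi\<close> is built first, and
  continuation, symmetry and orders of zeros are read off from it.\<close>

lemma sum_cos_multiples:
  fixes l i :: nat
  assumes "l > 0"
  shows "(\<Sum>j<l. cos (2 * pi * real (i * j) / real l)) = (if l dvd i then real l else 0)"
proof -
  define z where "z = cis (2 * pi * real i / real l)"
  have Re: "cos (2 * pi * real (i * j) / real l) = Re (z ^ j)" for j
    by (simp only: z_def Complex.DeMoivre cis.sel) (simp add: mult_ac)
  have zl: "z ^ l = 1"
    unfolding z_def Complex.DeMoivre using assms cis_multiple_2pi[of "real i"] by (simp add: mult_ac)
  have z1: "z = 1 \<longleftrightarrow> l dvd i"
  proof -
    have "z = 1 \<longleftrightarrow> cos (2 * pi * real i / real l) = 1"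
      by (auto simp: z_def complex_eq_iff cos_one_sin_zero)
    also have "\<dots> \<longleftrightarrow> (\<exists>n::int. 2 * pi * real i / real l = of_int n * 2 * pi)"
      by (rule cos_one_2pi_int)
    also have "\<dots> \<longleftrightarrow> (\<exists>n::int. real i = of_int n * real l)"
      using assms by (intro ex_cong1) (auto simp: field_simps)
    also have "\<dots> \<longleftrightarrow> (\<exists>n::int. int i = n * int l)"
      by (metis of_int_eq_iff of_int_mult of_int_of_nat_eq)
    also have "\<dots> \<longleftrightarrow> l dvd i"
      by (metis dvd_def int_dvd_int_iff mult.commute)
    finally show ?thesis .
  qed
  show ?thesis
  proof (cases "z = 1")
    case True
    then show ?thesis using z1 by (simp add: Re del: of_nat_mult)
  next
    case False
    have "(\<Sum>j<l. z ^ j) = 0"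
      using False zl by (simp add: sum_gp_strict)
    hence "Re (\<Sum>j<l. z ^ j) = 0" by simp
    then show ?thesis using z1 False by (simp add: Re del: of_nat_mult)
  qed
qed

text \<open>In the binomial expansion of \<open>(cis x + cis (- x)) ^ (2 * m)\<close> the real parts
  at distance \<open>i\<close> on either side of the centre \<open>m\<close> agree, because the
  coefficients are symmetric and the cosine is even. Indexing by the distance from the centre
  prepares the local limit theorem.\<close>

lemma cos_power_even_expansion:
  fixes x :: real
  shows "(2 * cos x) ^ (2 * m) =
         real ((2 * m) choose m) + 2 * (\<Sum>i=1..m. real ((2 * m) choose (m + i)) * cos (2 * real i * x))"
proof -
  have *: "cos (real r * x - (real (2*m) - real r) * x) = cos (2 * (real m - real r) * x)" for r
    by (subst cos_minus [symmetric]) (simp add: algebra_simps)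
  have "complex_of_real ((2 * cos x) ^ (2 * m)) = (cis x + cis (-x)) ^ (2 * m)"
    by (simp add: complex_eq_iff cis.ctr)
  also have "\<dots> = (\<Sum>r\<le>2*m. of_nat ((2*m) choose r) * cis (real r * x - (real (2*m) - real r) * x))"
    by (subst binomial_ring, intro sum.cong refl)
       (auto simp only: Complex.DeMoivre cis_mult mult.assoc of_nat_diff atMost_iff minus_mult_right diff_conv_add_uminus)
  finally have "Re (complex_of_real ((2 * cos x) ^ (2 * m))) = Re (\<Sum>r\<le>2*m. of_nat ((2*m) choose r) * cis (real r * x - (real (2*m) - real r) * x))"
    by simp
  hence "(2 * cos x) ^ (2 * m) = (\<Sum>r\<le>2*m. real ((2*m) choose r) * cos (2 * (real m - real r) * x))"
    unfolding * [symmetric] by (simp add: Re_sum)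
  also have "{..2*m} = {..<m} \<union> {m} \<union> {m+1..2*m}" by auto
  also have "(\<Sum>r\<in>\<dots>. real ((2*m) choose r) * cos (2 * (real m - real r) * x)) =
     (\<Sum>r<m. real ((2*m) choose r) * cos (2 * (real m - real r) * x)) + real ((2*m) choose m) +
     (\<Sum>r=m+1..2*m. real ((2*m) choose r) * cos (2 * (real m - real r) * x))"
    by (subst sum.union_disjoint; (subst sum.union_disjoint)?; auto)
  also have "(\<Sum>r<m. real ((2*m) choose r) * cos (2 * (real m - real r) * x)) =
             (\<Sum>i=1..m. real ((2 * m) choose (m + i)) * cos (2 * real i * x))"
  proof (rule sum.reindex_bij_witness[of _ "\<lambda>i. m - i" "\<lambda>r. m - r"])
    fix r assume r: "r \<in> {..<m}"
    hence "(2 * m) choose r = (2 * m) choose (m + (m - r))"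
      using binomial_symmetric[of r "2 * m"] by (simp add: mult_2)
    thus "real (2 * m choose (m + (m - r))) * cos (2 * real (m - r) * x) =
         real (2 * m choose r) * cos (2 * (real m - real r) * x)"
      using r by (simp add: of_nat_diff)
  qed auto
  also have "(\<Sum>r=m+1..2*m. real ((2*m) choose r) * cos (2 * (real m - real r) * x)) =
             (\<Sum>i=1..m. real ((2 * m) choose (m + i)) * cos (2 * real i * x))"
  proof (rule sum.reindex_bij_witness[of _ "\<lambda>i. m + i" "\<lambda>r. r - m"])
    fix r assume "r \<in> {m+1..2*m}"
    hence "2 * real (r - m) * x = - (2 * (real m - real r) * x)" "m + (r - m) = r"
      by (auto simp: of_nat_diff algebra_simps)
    thus "real (2 * m choose (m + (r - m))) * cos (2 * real (r - m) * x) =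
         real (2 * m choose r) * cos (2 * (real m - real r) * x)"
      by (metis cos_minus)
  qed auto
  finally show ?thesis by simp
qed

text \<open>
  A discrete form of Poisson summation, due to Polya: averaging \<open>(2 cos x)\<^bsup>2m\<^esup>\<close> over the
  \<open>l\<close>-th roots of unity picks out every \<open>l\<close>-th binomial coefficient. An odd \<open>l\<close> lets the
  nodes be paired by \<open>j \<mapsto> l - j\<close>.
\<close>

lemma binomial_filter_identity:
  fixes m p :: nat
  defines "l \<equiv> 2 * p + 1"
  shows "1 + 2 * (\<Sum>j=1..p. cos (pi * real j / real l) ^ (2 * m)) =
         real l / 4 ^ m * (real ((2*m) choose m) + 2 * (\<Sum>k=1..m. real ((2*m) choose (m + k * l))))"
proof -
  have l: "l > 0" by (simp add: l_def)
  have "(\<Sum>j<l. cos (pi * real j / real l) ^ (2 * m)) =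
        (\<Sum>j<l. (2 * cos (pi * real j / real l)) ^ (2 * m)) / 4 ^ m"
    by (simp add: power_mult_distrib power_mult sum_divide_distrib flip: sum_distrib_left)
  also have "(\<Sum>j<l. (2 * cos (pi * real j / real l)) ^ (2 * m)) =
     (\<Sum>j<l. real ((2 * m) choose m)) + 2 * (\<Sum>i=1..m. real ((2 * m) choose (m + i)) * (\<Sum>j<l. cos (2 * pi * real (i * j) / real l)))"
    unfolding cos_power_even_expansion sum.distrib sum_distrib_left
    by (subst (2) sum.swap) (simp add: mult_ac)
  also have "(\<Sum>i=1..m. real ((2 * m) choose (m + i)) * (\<Sum>j<l. cos (2 * pi * real (i * j) / real l))) =
     (\<Sum>i\<in>{i\<in>{1..m}. l dvd i}. real ((2 * m) choose (m + i)) * real l)"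
    by (subst sum.inter_filter, simp, intro sum.cong refl) (subst sum_cos_multiples[OF l], simp)
  also have "\<dots> = (\<Sum>k\<in>{k\<in>{1..m}. k * l \<le> m}. real ((2 * m) choose (m + k * l)) * real l)"
    by (rule sum.reindex_bij_witness[of _ "\<lambda>k. k * l" "\<lambda>i. i div l"])
       (use l in \<open>auto simp: Suc_le_eq intro: order.trans[of _ "_ * l"] order.trans[OF div_le_dividend]\<close>)
  \<comment> \<open>For \<open>k * l > m\<close> the lower index exceeds \<open>2 * m\<close>, so
    the added coefficients vanish.\<close>
  also have "\<dots> = (\<Sum>k=1..m. real ((2 * m) choose (m + k * l)) * real l)"
    by (rule sum.mono_neutral_left) auto
  finally have 1: "(\<Sum>j<l. cos (pi * real j / real l) ^ (2 * m)) =
       real l / 4 ^ m * (real ((2*m) choose m) + 2 * (\<Sum>k=1..m. real ((2*m) choose (m + k * l))))"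
    by (simp add: field_simps sum_distrib_left sum_distrib_right)
  have "{..<l} = {0} \<union> {1..p} \<union> {p+1..<l}" by (auto simp: l_def)
  also have "(\<Sum>j\<in>\<dots>. cos (pi * real j / real l) ^ (2 * m)) = 1 + (\<Sum>j=1..p. cos (pi * real j / real l) ^ (2 * m)) +
      (\<Sum>j=p+1..<l. cos (pi * real j / real l) ^ (2 * m))"
    by (subst sum.union_disjoint; (subst sum.union_disjoint)?; auto)
  also have "(\<Sum>j=p+1..<l. cos (pi * real j / real l) ^ (2 * m)) = (\<Sum>j=1..p. cos (pi * real j / real l) ^ (2 * m))"
  proof (rule sum.reindex_bij_witness[of _ "\<lambda>j. l - j" "\<lambda>j. l - j"])
    fix j assume j: "j \<in> {p+1..<l}"
    have "pi * real (l - j) / real l = pi - pi * real j / real l"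
      using j l by (auto simp: of_nat_diff field_simps)
    thus "cos (pi * real (l - j) / real l) ^ (2 * m) = cos (pi * real j / real l) ^ (2 * m)"
      by (simp add: power_mult)
  qed (auto simp: l_def)
  finally show ?thesis using 1 by simp
qed

text \<open>Consecutive coefficients have the quotient \<open>1 - (2 r + 1) / (m + r + 1)\<close>,
  and the odd numbers \<open>2 r + 1\<close> add up to the square in the exponent. The inequality
  \<open>1 + t \<le> exp t\<close> gives the upper bound when applied to the quotient and the lower
  bound when applied to its reciprocal. The fixed \<open>R\<close> keeps the denominator of the
  exponent constant during the induction.\<close>

lemma central_binomial_ratio_bounds:
  assumes "r \<le> R" "R \<le> m"
  shows "real ((2*m) choose (m + r)) \<le> real ((2*m) choose m) * exp (- (real r)\<^sup>2 / real (m + R))"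
    and "R < m \<Longrightarrow> real ((2*m) choose (m + r)) \<ge> real ((2*m) choose m) * exp (- (real r)\<^sup>2 / real (m - R))"
proof -
  have "real ((2*m) choose (m + r)) \<le> real ((2*m) choose m) * exp (- (real r)\<^sup>2 / real (m + R)) \<and>
        (R < m \<longrightarrow> real ((2*m) choose (m + r)) \<ge> real ((2*m) choose m) * exp (- (real r)\<^sup>2 / real (m - R)))"
    using assms(1)
  proof (induction r)
    case 0
    then show ?case by simp
  next
    case (Suc r)
    define u where "u = (real m - real r) / (real m + real r + 1)"
    have r: "Suc r \<le> R" "r < m" using Suc.prems assms(2) by auto
    have "(m + r + 1) * ((2*m) choose (m + Suc r)) = (m - r) * ((2*m) choose (m + r))"
      using binomial_absorb_comp[of "2*m" "m+r"] binomial_absorption[of "m+r" "2*m"] by simp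
    hence "real (m + r + 1) * real ((2*m) choose (m + Suc r)) = real (m - r) * real ((2*m) choose (m + r))"
      by (metis of_nat_mult)
    hence eq: "real ((2*m) choose (m + Suc r)) = u * real ((2*m) choose (m + r))"
      using r by (simp add: u_def of_nat_diff field_simps)
    have u1: "u = 1 - (2 * real r + 1) / (real m + real r + 1)"
      by (simp add: u_def field_simps)
    have u0: "u > 0" using r by (auto simp: u_def)
    have "u \<le> exp (- ((2 * real r + 1) / (real m + real r + 1)))"
      using exp_ge_add_one_self[of "- ((2 * real r + 1) / (real m + real r + 1))"] u1 by simp
    also have "\<dots> \<le> exp (- ((2 * real r + 1) / real (m + R)))"
      using r by (auto intro!: divide_left_mono)
    finally have U: "u \<le> exp (- ((2 * real r + 1) / real (m + R)))" .
    have L: "exp (- ((2 * real r + 1) / real (m - R))) \<le> u" if "R < m"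
    proof -
      have "inverse u = 1 + (2 * real r + 1) / (real m - real r)"
        using r by (simp add: u_def field_simps)
      also have "\<dots> \<le> exp ((2 * real r + 1) / (real m - real r))"
        by (rule exp_ge_add_one_self)
      also have "\<dots> \<le> exp ((2 * real r + 1) / real (m - R))"
        using r that by (auto intro!: divide_left_mono simp: of_nat_diff)
      finally show ?thesis
        using u0 by (simp add: exp_minus field_simps)
    qed
    have e: "exp (- (real (Suc r))\<^sup>2 / c) = exp (- ((2 * real r + 1) / c)) * exp (- (real r)\<^sup>2 / c)" for c :: real
      by (simp add: exp_add [symmetric] add_divide_distrib [symmetric] power2_eq_square algebra_simps diff_divide_distrib)
    show ?case
      unfolding eq e
      using mult_mono[OF U, of "real ((2*m) choose (m + r))" "real ((2*m) choose m) * exp (- (real r)\<^sup>2 / real (m + R))"]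
            mult_mono[OF L, of "real ((2*m) choose m) * exp (- (real r)\<^sup>2 / real (m - R))" "real ((2*m) choose (m + r))" ]
            Suc.IH r u0
      by (simp add: mult_ac)
  qed
  thus "real ((2*m) choose (m + r)) \<le> real ((2*m) choose m) * exp (- (real r)\<^sup>2 / real (m + R))"
    "R < m \<Longrightarrow> real ((2*m) choose (m + r)) \<ge> real ((2*m) choose m) * exp (- (real r)\<^sup>2 / real (m - R))" by auto
qed

text \<open>The square of each term is the reciprocal of a partial product of Wallis, and these
  products tend to \<open>pi / 2\<close>.\<close>

lemma central_binomial_asymptotics:
  "(\<lambda>m. real ((2*m) choose m) / 4 ^ m * sqrt (real (2 * m + 1))) \<longlonglongrightarrow> sqrt (2 / pi)"
proof -
  have eq: "real ((2*m) choose m) / 4 ^ m * sqrt (real (2 * m + 1)) =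
        sqrt (inverse (\<Prod>k=1..m. (4*real k^2) / (4*real k^2 - 1)))" for m
  proof -
    have "(real ((2*m) choose m) / 4 ^ m)\<^sup>2 * real (2 * m + 1) = inverse (\<Prod>k=1..m. (4*real k^2) / (4*real k^2 - 1))"
    proof (induction m)
      case 0
      then show ?case by simp
    next
      case (Suc m)
      have "(m + 1) * ((2 * Suc m) choose Suc m) = 2 * (2 * m + 1) * ((2*m) choose m)"
      proof -
        have "Suc m * ((2 * Suc m) choose Suc m) = (2 * m + 2) * ((2 * m + 1) choose m)"
          using Suc_times_binomial_eq[of "2*m+1" m] by simp
        moreover have B: "(m + 1) * ((2 * m + 1) choose m) = (2 * m + 1) * ((2 * m) choose m)"
          using binomial_absorb_comp[of "2*m+1" m] by simp
        ultimately have "Suc m * ((2 * Suc m) choose Suc m) = Suc m * (2 * ((2 * m + 1) choose m))"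
          by (simp add: algebra_simps)
        hence "(2 * Suc m) choose Suc m = 2 * ((2 * m + 1) choose m)"
          using mult_cancel1 by blast
        hence "(m + 1) * ((2 * Suc m) choose Suc m) = 2 * ((m + 1) * ((2 * m + 1) choose m))"
          by (simp only: mult_ac)
        thus ?thesis by (simp only: B mult.assoc)
      qed
      hence "real (m + 1) * real ((2 * Suc m) choose Suc m) = real (2 * (2 * m + 1)) * real ((2*m) choose m)"
        by (metis of_nat_mult)
      hence *: "real ((2 * Suc m) choose Suc m) = 2 * (2 * real m + 1) / (real m + 1) * real ((2*m) choose m)"
        by (simp add: field_simps)
      have "(real ((2*Suc m) choose Suc m) / 4 ^ Suc m)\<^sup>2 * real (2 * Suc m + 1) =
         ((real ((2*m) choose m) / 4 ^ m)\<^sup>2 * real (2 * m + 1)) * ((2 * real m + 1) * (2 * real m + 3) / (4 * (real m + 1)^2))"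
      proof -
        have "(2 * w / q * A / (4 * P))\<^sup>2 * v = (A / P)\<^sup>2 * w * (w * v / (4 * q\<^sup>2))"
          if "q \<noteq> 0" "P \<noteq> 0" for w q A P v :: real
          using that by (simp add: field_simps power2_eq_square)
        from this[of "real m + 1" "4 ^ m" "2 * real m + 1" "real ((2*m) choose m)" "2 * real m + 3"]
        show ?thesis unfolding * by (simp add: add_ac)
      qed
      also have "\<dots> = inverse (\<Prod>k=1..Suc m. (4*real k^2) / (4*real k^2 - 1))"
        unfolding Suc.IH by (simp add: field_simps power2_eq_square)
      finally show ?case .
    qed
    thus ?thesis
      by (intro real_sqrt_unique [symmetric]) (simp_all add: power_mult_distrib power_divide)
  qed
  have "(\<lambda>m. sqrt (inverse (\<Prod>k=1..m. (4*real k^2) / (4*real k^2 - 1)))) \<longlonglongrightarrow> sqrt (inverse (pi / 2))"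
    by (intro tendsto_intros wallis) auto
  moreover have "sqrt (inverse (pi / 2)) = sqrt (2 / pi)" by simp
  ultimately show ?thesis unfolding eq by simp
qed

text \<open>Jacobi's theta function is \<open>1 + 2 * theta_tail x\<close>.\<close>

definition theta_tail :: "real \<Rightarrow> real" where
  "theta_tail x = (\<Sum>n. exp (- pi * (real (Suc n))\<^sup>2 * x))"

text \<open>On the range of \<open>x / 2\<close> one has \<open>sin y \<ge> y / 2\<close>, so
  \<open>cos x = 1 - 2 (sin (x / 2))^2\<close> is at most \<open>1 - x^2 / 8\<close>. The constant
  is not sharp; the bound only has to supply a Gaussian majorant.\<close>

lemma cos_le_exp_neg_square:
  assumes "0 \<le> x" "x \<le> pi / 2"
  shows "cos x \<le> exp (- x\<^sup>2 / 8)"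
proof -
  have "(\<lambda>y. sin y - y / 2) 0 \<le> (\<lambda>y. sin y - y / 2) (x / 2)"
  proof (rule DERIV_nonneg_imp_nondecreasing[of 0 "x / 2" "\<lambda>y. sin y - y / 2"])
    fix y assume y: "0 \<le> y" "y \<le> x / 2"
    have "cos (pi / 3) \<le> cos y"
      using y assms pi_gt_zero by (intro cos_monotone_0_pi_le) auto
    hence "cos y - 1 / 2 \<ge> 0" by (simp add: cos_60)
    moreover have "((\<lambda>y. sin y - y / 2) has_real_derivative (cos y - 1 / 2)) (at y)"
      by (auto intro!: derivative_eq_intros)
    ultimately show "\<exists>d. ((\<lambda>y. sin y - y / 2) has_real_derivative d) (at y) \<and> d \<ge> 0" by blast
  qed (use assms in auto)
  hence "(x / 4)\<^sup>2 \<le> (sin (x/2))\<^sup>2"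
    using assms by (intro power_mono) auto
  moreover have "cos x = 1 - 2 * (sin (x/2))\<^sup>2"
    using cos_double_sin[of "x/2"] by simp
  ultimately have "cos x \<le> 1 + (- x\<^sup>2 / 8)"
    by (simp add: power2_eq_square)
  also have "\<dots> \<le> exp (- x\<^sup>2 / 8)" by (rule exp_ge_add_one_self)
  finally show ?thesis .
qed

lemma summable_exp_neg_Suc:
  assumes "c > (0::real)"
  shows "summable (\<lambda>n. exp (- c * real (Suc n)))"
proof -
  have "summable (\<lambda>n. exp (- c) ^ Suc n)"
    using assms by (subst summable_Suc_iff) (auto intro!: summable_geometric)
  thus ?thesis by (simp add: exp_of_nat_mult [symmetric] mult_ac del: power_Suc of_nat_Suc)
qed

text \<open>
  Let \<open>m \<sim> (x / pi) l\<^sup>2\<close> in \<open>binomial_filter_identity\<close>. The left-hand side tends to the theta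
  function at \<open>x\<close> because \<open>cos y\<close> behaves like \<open>exp (- y\<^sup>2 / 2)\<close>, the right-hand side to the one at
  \<open>1 / x\<close> by the local central limit theorem; Gaussian bounds on both sides justify the
  termwise limits.
\<close>

lemma theta_tail_inversion:
  assumes x: "x > 0"
  shows "sqrt x * (1 + 2 * theta_tail x) = 1 + 2 * theta_tail (1 / x)"
proof -
  \<comment> \<open>For \<open>m\<close> near \<open>\<tau> l^2\<close> the power
    \<open>cos (pi k / l) ^ (2 m)\<close> is about \<open>exp (- pi^2 k^2 \<tau>)\<close>, and this
    has to be \<open>exp (- pi k^2 x)\<close>.\<close>
  define \<tau> where "\<tau> = x / pi"
  have \<tau>: "\<tau> > 0" using x by (simp add: \<tau>_def)
  define l where "l p = 2 * p + 1" for p :: nat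
  define m where "m p = nat \<lfloor>\<tau> * (real (l p))\<^sup>2\<rfloor>" for p
  have l0: "real (l p) > 0" for p by (simp add: l_def)
  have l_lim: "filterlim (\<lambda>p. real (l p)) at_top sequentially"
    unfolding l_def by real_asymp
  have m_le: "real (m p) / (real (l p))\<^sup>2 \<le> \<tau>" for p
    using \<tau> l0[of p] by (simp add: m_def field_simps)
  have m_ge: "real (m p) / (real (l p))\<^sup>2 \<ge> \<tau> - 1 / (real (l p))\<^sup>2" for p
  proof -
    have "real (m p) \<ge> \<tau> * (real (l p))\<^sup>2 - 1"
      using \<tau> unfolding m_def by linarith
    hence "(\<tau> * (real (l p))\<^sup>2 - 1) / (real (l p))\<^sup>2 \<le> real (m p) / (real (l p))\<^sup>2"
      by (rule divide_right_mono) simp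
    thus ?thesis using l0[of p] by (simp add: diff_divide_distrib)
  qed
  have m_lim: "(\<lambda>p. real (m p) / (real (l p))\<^sup>2) \<longlonglongrightarrow> \<tau>"
  proof (rule tendsto_sandwich)
    show "(\<lambda>p. \<tau> - 1 / (real (l p))\<^sup>2) \<longlonglongrightarrow> \<tau>" unfolding l_def by real_asymp
  qed (use m_le m_ge in auto)
  have m_top: "filterlim (\<lambda>p. real (m p)) at_top sequentially"
  proof -
    have "filterlim (\<lambda>p. real (m p) / (real (l p))\<^sup>2 * (real (l p))\<^sup>2) at_top sequentially"
      by (rule filterlim_tendsto_pos_mult_at_top[OF m_lim \<tau>]) (unfold l_def, real_asymp)
    thus ?thesis using l0 by (simp add: less_imp_neq[symmetric])
  qed
  hence m_top': "filterlim m at_top sequentially"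
    by (subst (asm) filterlim_sequentially_iff_filterlim_real [symmetric])
  have m_half: "eventually (\<lambda>p. real (m p) / (real (l p))\<^sup>2 \<ge> \<tau> / 2) sequentially"
    using order_tendstoD(1)[OF m_lim, of "\<tau> / 2"] \<tau> by (auto elim: eventually_mono)

  \<comment> \<open>The zero terms beyond \<open>p\<close> turn the finite sums into series with a
    common index set, so that Tannery's theorem applies; the shift by one matches
    \<open>theta_tail\<close>.\<close>
  define a where "a k p = (if Suc k \<le> p then cos (pi * real (Suc k) / real (l p)) ^ (2 * m p) else 0)" for k p
  have a_lim: "(\<lambda>p. a k p) \<longlonglongrightarrow> exp (- pi * (real (Suc k))\<^sup>2 * x)" for k
  proof -
    define c where "c = pi * real (Suc k)"
    have c: "c > 0" by (simp add: c_def)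
    have "((\<lambda>y. y\<^sup>2 * ln (cos (c / y))) \<longlongrightarrow> - (c * c / 2)) at_top"
      using c by real_asymp
    from filterlim_compose[OF this l_lim]
    have "(\<lambda>p. (real (l p))\<^sup>2 * ln (cos (c / real (l p)))) \<longlonglongrightarrow> - (c * c / 2)" .
    from tendsto_exp[OF tendsto_mult[OF tendsto_mult[OF tendsto_const[of 2] m_lim] this]]
    have "(\<lambda>p. exp (2 * (real (m p) / (real (l p))\<^sup>2) * ((real (l p))\<^sup>2 * ln (cos (c / real (l p)))))) \<longlonglongrightarrow> exp (2 * \<tau> * (- (c * c / 2)))" .
    also have "2 * \<tau> * (- (c * c / 2)) = - pi * (real (Suc k))\<^sup>2 * x"
      by (simp add: \<tau>_def c_def power2_eq_square)
    finally show ?thesis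
    proof (rule Lim_transform_eventually)
      show "eventually (\<lambda>p. exp (2 * (real (m p) / (real (l p))\<^sup>2) * ((real (l p))\<^sup>2 * ln (cos (c / real (l p))))) = a k p) sequentially"
        using eventually_ge_at_top[of "Suc k"]
      proof eventually_elim
        case (elim p)
        \<comment> \<open>As \<open>l = 2 p + 1\<close>, the nodes up to \<open>p\<close> stay below
          \<open>pi / 2\<close>; the cosine is positive there and its power can be written with a
          logarithm.\<close>
        have "real (Suc k) / real (l p) < 1 / 2"
          using elim l0[of p] by (simp add: l_def field_simps)
        hence "pi * (real (Suc k) / real (l p)) < pi * (1 / 2)"
          by (rule mult_strict_left_mono) simp
        hence "c / real (l p) < pi / 2" by (simp add: c_def)
        hence "cos (c / real (l p)) > 0"
          using c l0[of p] by (intro cos_gt_zero) auto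
        hence "cos (c / real (l p)) ^ (2 * m p) = exp (real (2 * m p) * ln (cos (c / real (l p))))"
          by (simp add: exp_of_nat_mult del: of_nat_mult)
        thus ?case using elim l0[of p] by (simp add: a_def c_def)
      qed
    qed
  qed
  have a_bound: "norm (a k p) \<le> exp (- (pi\<^sup>2 * \<tau> / 8) * real (Suc k))"
    if "real (m p) / (real (l p))\<^sup>2 \<ge> \<tau> / 2" for k p
  proof (cases "Suc k \<le> p")
    case True
    define y where "y = pi * real (Suc k) / real (l p)"
    have "real (Suc k) / real (l p) \<le> 1 / 2"
      using True l0[of p] by (simp add: l_def field_simps)
    hence "pi * (real (Suc k) / real (l p)) \<le> pi * (1 / 2)"
      by (rule mult_left_mono) simp
    hence y: "0 \<le> y" "y \<le> pi / 2"
      by (simp_all add: y_def)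
    have "norm (a k p) = cos y ^ (2 * m p)"
      using True y by (simp add: a_def y_def)
    also have "\<dots> \<le> exp (- y\<^sup>2 / 8) ^ (2 * m p)"
      using y by (intro power_mono cos_le_exp_neg_square cos_ge_zero) auto
    also have "\<dots> = exp (real (2 * m p) * (- y\<^sup>2 / 8))"
      by (simp only: exp_of_nat_mult)
    also have "real (2 * m p) * (- y\<^sup>2 / 8) = - (pi\<^sup>2 * (real (Suc k))\<^sup>2 / 4 * (real (m p) / (real (l p))\<^sup>2))"
      by (simp add: y_def power_divide power_mult_distrib)
    also have "exp \<dots> \<le> exp (- (pi\<^sup>2 * (real (Suc k))\<^sup>2 / 4 * (\<tau> / 2)))"
      using that by (subst exp_le_cancel_iff, subst neg_le_iff_le) (intro mult_left_mono, auto)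
    \<comment> \<open>A positive integer is at most its square; what results is a geometric majorant
      independent of \<open>p\<close>.\<close>
    also have "\<dots> \<le> exp (- (pi\<^sup>2 * real (Suc k) / 4 * (\<tau> / 2)))"
      using \<tau> by (subst exp_le_cancel_iff, subst neg_le_iff_le)
         (intro mult_right_mono divide_right_mono mult_left_mono, auto simp: power2_eq_square)
    finally show ?thesis by (simp add: mult_ac)
  qed (simp add: a_def)
  have "eventually (\<lambda>p. \<forall>k. norm (a k p) \<le> exp (- (pi\<^sup>2 * \<tau> / 8) * real (Suc k))) sequentially"
    using m_half by eventually_elim (use a_bound in blast)
  hence "eventually (\<lambda>z. \<forall>k. norm (a k (snd z)) \<le> exp (- (pi\<^sup>2 * \<tau> / 8) * real (Suc k))) (at_top \<times>\<^sub>F sequentially)"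
    by (rule eventually_compose_filterlim[OF _ filterlim_snd])
  hence "eventually (\<lambda>(k,p). norm (a k p) \<le> exp (- (pi\<^sup>2 * \<tau> / 8) * real (Suc k))) (at_top \<times>\<^sub>F sequentially)"
    by (rule eventually_mono) auto
  from tannerys_theorem[OF a_lim this summable_exp_neg_Suc] \<tau>
  have "(\<lambda>p. suminf (\<lambda>k. a k p)) \<longlonglongrightarrow> theta_tail x"
    by (simp add: theta_tail_def)
  hence lim1: "(\<lambda>p. 1 + 2 * suminf (\<lambda>k. a k p)) \<longlonglongrightarrow> 1 + 2 * theta_tail x"
    by (intro tendsto_intros)

  \<comment> \<open>Division by the central coefficient leaves the Gaussian profile, and the
    coefficient itself becomes a common factor with known asymptotics.\<close>
  define b where "b k p = real ((2 * m p) choose (m p + Suc k * l p)) / real ((2 * m p) choose m p)" for k p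
  have C0: "real ((2 * m p) choose m p) > 0" for p by simp
  have b_lim: "(\<lambda>p. b k p) \<longlonglongrightarrow> exp (- pi * (real (Suc k))\<^sup>2 * (1 / x))" for k
  proof -
    define K where "K = Suc k"
    \<comment> \<open>The lower bound uses \<open>s = -1\<close> and the upper bound
      \<open>s = 1\<close>. After division by \<open>l^2\<close> the term with \<open>s\<close> is
      of order \<open>1 / l\<close>, so both have the same limit.\<close>
    have sq: "exp (- (real (K * l p))\<^sup>2 / (real (m p) + s * real (K * l p))) =
          exp (- (real K)\<^sup>2 / (real (m p) / (real (l p))\<^sup>2 + s * (real K / real (l p))))" for p s
      using l0[of p] by (simp add: field_simps power2_eq_square)
    have lim: "(\<lambda>p. exp (- (real (K * l p))\<^sup>2 / (real (m p) + s * real (K * l p)))) \<longlonglongrightarrow> exp (- (real K)\<^sup>2 / (\<tau> + s * 0))" for s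
      unfolding sq
      by (intro tendsto_intros m_lim real_tendsto_divide_at_top[OF tendsto_const] l_lim) (use \<tau> in auto)
    have ev: "eventually (\<lambda>p. K * l p < m p) sequentially"
    proof -
      have "(\<lambda>p. real K / real (l p)) \<longlonglongrightarrow> 0"
        by (intro real_tendsto_divide_at_top[OF tendsto_const] l_lim)
      hence "eventually (\<lambda>p. real K / real (l p) < \<tau> / 2) sequentially"
        using \<tau> by (intro order_tendstoD(2)[where y = 0]) auto
      thus ?thesis using m_half
      proof eventually_elim
        case (elim p)
        hence "real K / real (l p) < real (m p) / (real (l p))\<^sup>2" by linarith
        hence "real (K * l p) < real (m p)"
          using l0[of p] by (simp add: field_simps power2_eq_square)
        thus ?case by (simp only: of_nat_less_iff)
      qed
    qed
    have "(\<lambda>p. b k p) \<longlonglongrightarrow> exp (- (real K)\<^sup>2 / \<tau>)"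
    proof (rule tendsto_sandwich)
      show "eventually (\<lambda>p. exp (- (real (K * l p))\<^sup>2 / (real (m p) + (-1) * real (K * l p))) \<le> b k p) sequentially"
        using ev
      proof eventually_elim
        case (elim p)
        have "real (m p - K * l p) = real (m p) + (-1) * real (K * l p)" using elim by (simp add: of_nat_diff)
        thus ?case
          using central_binomial_ratio_bounds(2)[of "K * l p" "K * l p" "m p"] elim C0[of p]
          unfolding b_def K_def [symmetric] by (subst pos_le_divide_eq) (simp_all only: mult.commute order.refl)
      qed
      show "eventually (\<lambda>p. b k p \<le> exp (- (real (K * l p))\<^sup>2 / (real (m p) + 1 * real (K * l p)))) sequentially"
        using ev
      proof eventually_elim
        case (elim p)
        thus ?case
          using central_binomial_ratio_bounds(1)[of "K * l p" "K * l p" "m p"] C0[of p]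
          unfolding b_def K_def [symmetric] by (subst pos_divide_le_eq) (simp_all add: mult.commute)
      qed
      show "(\<lambda>p. exp (- (real (K * l p))\<^sup>2 / (real (m p) + (-1) * real (K * l p)))) \<longlonglongrightarrow> exp (- (real K)\<^sup>2 / \<tau>)"
        using lim[of "-1"] by simp
      show "(\<lambda>p. exp (- (real (K * l p))\<^sup>2 / (real (m p) + 1 * real (K * l p)))) \<longlonglongrightarrow> exp (- (real K)\<^sup>2 / \<tau>)"
        using lim[of 1] by simp
    qed
    also have "- (real K)\<^sup>2 / \<tau> = - pi * (real (Suc k))\<^sup>2 * (1 / x)"
      using x by (simp add: \<tau>_def K_def)
    finally show ?thesis .
  qed
  have b_bound: "norm (b k p) \<le> exp (- (1 / (2 * \<tau>)) * real (Suc k))" if "m p > 0" for k p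
  proof (cases "Suc k * l p \<le> m p")
    case True
    define r where "r = Suc k * l p"
    have "norm (b k p) = real ((2 * m p) choose (m p + r)) / real ((2 * m p) choose m p)"
      by (simp add: b_def r_def del: mult_Suc of_nat_Suc of_nat_mult)
    also have "\<dots> \<le> exp (- (real r)\<^sup>2 / real (m p + r))"
      using central_binomial_ratio_bounds(1)[of r r "m p"] C0[of p] True by (simp add: r_def field_simps)
    also have "\<dots> \<le> exp (- ((real (Suc k))\<^sup>2 / (2 * \<tau>)))"
    proof -
      have "(real (Suc k))\<^sup>2 / (2 * \<tau>) \<le> (real r)\<^sup>2 / (2 * real (m p))"
      proof -
        have "(real (Suc k))\<^sup>2 / (2 * \<tau>) \<le> (real (Suc k))\<^sup>2 / (2 * (real (m p) / (real (l p))\<^sup>2))"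
          using m_le[of p] \<tau> l0[of p] that by (intro divide_left_mono mult_pos_pos) auto
        also have "\<dots> = (real r)\<^sup>2 / (2 * real (m p))"
          unfolding r_def of_nat_mult power_mult_distrib by simp
        finally show ?thesis .
      qed
      also have "\<dots> \<le> (real r)\<^sup>2 / real (m p + r)"
      proof -
        have "r \<le> m p" using True by (simp only: r_def)
        thus ?thesis using that by (intro divide_left_mono) auto
      qed
      finally show ?thesis by simp
    qed
    also have "\<dots> \<le> exp (- (real (Suc k) / (2 * \<tau>)))"
      using \<tau> by (subst exp_le_cancel_iff, subst neg_le_iff_le)
         (intro divide_right_mono, auto simp: power2_eq_square)
    finally show ?thesis by simp
  next
    case False
    hence "b k p = 0" by (simp add: b_def)
    thus ?thesis by simp
  qed
  have "eventually (\<lambda>p. m p > 0) sequentially"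
    by (rule eventually_compose_filterlim[OF eventually_gt_at_top m_top'])
  hence "eventually (\<lambda>p. \<forall>k. norm (b k p) \<le> exp (- (1 / (2 * \<tau>)) * real (Suc k))) sequentially"
    by eventually_elim (use b_bound in blast)
  hence "eventually (\<lambda>z. \<forall>k. norm (b k (snd z)) \<le> exp (- (1 / (2 * \<tau>)) * real (Suc k))) (at_top \<times>\<^sub>F sequentially)"
    by (rule eventually_compose_filterlim[OF _ filterlim_snd])
  hence "eventually (\<lambda>(k,p). norm (b k p) \<le> exp (- (1 / (2 * \<tau>)) * real (Suc k))) (at_top \<times>\<^sub>F sequentially)"
    by (rule eventually_mono) auto
  from tannerys_theorem[OF b_lim this summable_exp_neg_Suc] \<tau>
  have "(\<lambda>p. suminf (\<lambda>k. b k p)) \<longlonglongrightarrow> theta_tail (1 / x)"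
    by (simp add: theta_tail_def)
  \<comment> \<open>The prefactor \<open>l / 4 ^ m\<close> times the central coefficient, split so
    that \<open>central_binomial_asymptotics\<close> applies. Since
    \<open>l / sqrt (2 m + 1)\<close> tends to \<open>1 / sqrt (2 \<tau>)\<close>, the product tends
    to \<open>1 / sqrt (pi \<tau>) = 1 / sqrt x\<close>.\<close>
  moreover have "(\<lambda>p. real (l p) / sqrt (real (2 * m p + 1)) * (real ((2 * m p) choose m p) / 4 ^ m p * sqrt (real (2 * m p + 1)))) \<longlonglongrightarrow> 1 / sqrt (2 * \<tau>) * sqrt (2 / pi)"
  proof (intro tendsto_mult)
    have "(\<lambda>p. 1 / sqrt (2 * (real (m p) / (real (l p))\<^sup>2) + 1 / (real (l p))\<^sup>2)) \<longlonglongrightarrow> 1 / sqrt (2 * \<tau> + 0)"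
      by (intro tendsto_intros m_lim) (use \<tau> in \<open>auto simp: l_def, real_asymp\<close>)
    also have "(\<lambda>p. 1 / sqrt (2 * (real (m p) / (real (l p))\<^sup>2) + 1 / (real (l p))\<^sup>2)) = (\<lambda>p. real (l p) / sqrt (real (2 * m p + 1)))"
    proof
      fix p
      have "2 * (real (m p) / (real (l p))\<^sup>2) + 1 / (real (l p))\<^sup>2 = real (2 * m p + 1) / (real (l p))\<^sup>2"
        by (simp add: add_divide_distrib)
      thus "1 / sqrt (2 * (real (m p) / (real (l p))\<^sup>2) + 1 / (real (l p))\<^sup>2) = real (l p) / sqrt (real (2 * m p + 1))"
        using l0[of p] by (simp add: real_sqrt_divide del: of_nat_add of_nat_mult)
    qed
    finally show "(\<lambda>p. real (l p) / sqrt (real (2 * m p + 1))) \<longlonglongrightarrow> 1 / sqrt (2 * \<tau>)" by simp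
    show "(\<lambda>p. real ((2 * m p) choose m p) / 4 ^ m p * sqrt (real (2 * m p + 1))) \<longlonglongrightarrow> sqrt (2 / pi)"
      by (rule filterlim_compose[OF central_binomial_asymptotics m_top'])
  qed
  moreover have "1 / sqrt (2 * \<tau>) * sqrt (2 / pi) = 1 / sqrt x"
    using x by (simp add: \<tau>_def real_sqrt_divide real_sqrt_mult)
  ultimately have lim2: "(\<lambda>p. real (l p) / sqrt (real (2 * m p + 1)) * (real ((2 * m p) choose m p) / 4 ^ m p * sqrt (real (2 * m p + 1))) * (1 + 2 * suminf (\<lambda>k. b k p))) \<longlonglongrightarrow> 1 / sqrt x * (1 + 2 * theta_tail (1 / x))"
    by (intro tendsto_mult tendsto_add tendsto_const) simp_all
  have "1 + 2 * suminf (\<lambda>k. a k p) = real (l p) / sqrt (real (2 * m p + 1)) * (real ((2 * m p) choose m p) / 4 ^ m p * sqrt (real (2 * m p + 1))) * (1 + 2 * suminf (\<lambda>k. b k p))" for p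
  proof -
    have "suminf (\<lambda>k. a k p) = (\<Sum>k<p. a k p)"
      by (rule suminf_finite) (auto simp: a_def)
    also have "\<dots> = (\<Sum>j=1..p. cos (pi * real j / real (l p)) ^ (2 * m p))"
      by (rule sum.reindex_bij_witness[of _ "\<lambda>j. j - 1" Suc]) (auto simp: a_def)
    finally have A: "suminf (\<lambda>k. a k p) = (\<Sum>j=1..p. cos (pi * real j / real (l p)) ^ (2 * m p))" .
    have "suminf (\<lambda>k. b k p) = (\<Sum>k<m p. b k p)"
    proof (rule suminf_finite)
      fix k assume "k \<notin> {..<m p}"
      hence "m p < Suc k * l p" by (simp add: l_def)
      thus "b k p = 0" by (simp add: b_def)
    qed auto
    also have "\<dots> = (\<Sum>k=1..m p. real ((2 * m p) choose (m p + k * l p)) / real ((2 * m p) choose m p))"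
      by (rule sum.reindex_bij_witness[of _ "\<lambda>j. j - 1" Suc]) (auto simp: b_def)
    finally have B: "real ((2 * m p) choose m p) * suminf (\<lambda>k. b k p) = (\<Sum>k=1..m p. real ((2 * m p) choose (m p + k * l p)))"
      using C0[of p] by (simp add: sum_divide_distrib [symmetric])
    show ?thesis
      unfolding A using binomial_filter_identity[of p "m p", folded l_def] B
      by (simp add: algebra_simps add_divide_distrib)
  qed
  from lim2[folded this] have "(\<lambda>p. 1 + 2 * suminf (\<lambda>k. a k p)) \<longlonglongrightarrow> 1 / sqrt x * (1 + 2 * theta_tail (1 / x))" .
  with lim1 have "1 + 2 * theta_tail x = 1 / sqrt x * (1 + 2 * theta_tail (1 / x))"
    by (rule LIMSEQ_unique)
  thus ?thesis using x by simp
qed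

section \<open>The completed zeta function\<close>

lemma theta_tail_summable:
  assumes "x > 0"
  shows "summable (\<lambda>n. exp (- pi * (real (Suc n))\<^sup>2 * x))"
proof (rule summable_comparison_test[OF _ summable_exp_neg_Suc[of "pi * x"]], intro exI allI impI)
  fix n :: nat
  have "real (Suc n) * 1 \<le> real (Suc n) * real (Suc n)" by (intro mult_left_mono) auto
  hence "pi * x * real (Suc n) \<le> pi * x * (real (Suc n))\<^sup>2"
    using assms by (intro mult_left_mono) (auto simp: power2_eq_square)
  thus "norm (exp (- pi * (real (Suc n))\<^sup>2 * x)) \<le> exp (- (pi * x) * real (Suc n))"
    by (simp add: mult_ac)
qed (use assms in auto)

lemma theta_tail_nonneg: "x > 0 \<Longrightarrow> theta_tail x \<ge> 0"
  unfolding theta_tail_def by (intro suminf_nonneg theta_tail_summable) auto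

text \<open>Replacing the squares by first powers leaves a geometric series whose ratio
  \<open>exp (- pi * x)\<close> is at most \<open>1 / 2\<close>, hence a sum of at most twice the
  first term.\<close>

lemma theta_tail_le:
  assumes "x \<ge> 1"
  shows "theta_tail x \<le> 2 * exp (- pi * x)"
proof -
  define q where "q = exp (- pi * x)"
  have "1 * 1 \<le> pi * x" using assms pi_ge_two by (intro mult_mono) auto
  hence "q \<le> exp (- 1)" by (simp add: q_def)
  also have "exp (- 1) \<le> (1 / 2 :: real)"
    using exp_ge_add_one_self[of "1::real"] by (simp add: exp_minus field_simps)
  finally have q: "0 < q" "q \<le> 1 / 2" by (auto simp: q_def)
  have "theta_tail x \<le> (\<Sum>n. q * q ^ n)"
    unfolding theta_tail_def
  proof (rule suminf_le)
    fix n
    have "real (Suc n) * 1 \<le> real (Suc n) * real (Suc n)" by (intro mult_left_mono) auto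
    hence "pi * x * real (Suc n) \<le> pi * x * (real (Suc n))\<^sup>2"
      using assms by (intro mult_left_mono) (auto simp: power2_eq_square)
    hence "exp (- pi * (real (Suc n))\<^sup>2 * x) \<le> exp (real (Suc n) * (- pi * x))"
      by (simp add: mult_ac)
    also have "\<dots> = q * q ^ n" by (simp only: exp_of_nat_mult q_def power_Suc)
    finally show "exp (- pi * (real (Suc n))\<^sup>2 * x) \<le> q * q ^ n" .
  next
    show "summable (\<lambda>n. exp (- pi * (real (Suc n))\<^sup>2 * x))"
      by (rule theta_tail_summable) (use assms in simp)
    show "summable (\<lambda>n. q * q ^ n)"
      by (intro summable_mult summable_geometric) (use q in simp)
  qed
  also have "\<dots> = q * (1 / (1 - q))"
    using q by (subst suminf_mult) (auto intro!: summable_geometric simp: suminf_geometric)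
  also have "\<dots> \<le> q * 2"
    using q by (intro mult_left_mono) (auto simp: field_simps)
  finally show ?thesis by (simp add: q_def)
qed

lemma isCont_theta_tail:
  assumes "x > 0"
  shows "isCont theta_tail x"
proof -
  have "uniform_limit {x/2..} (\<lambda>N y. \<Sum>n<N. exp (- pi * (real (Suc n))\<^sup>2 * y))
          (\<lambda>y. \<Sum>n. exp (- pi * (real (Suc n))\<^sup>2 * y)) sequentially"
    by (rule Weierstrass_m_test[OF _ theta_tail_summable[of "x/2"]])
       (use assms in \<open>auto intro!: mult_left_mono\<close>)
  hence "continuous_on {x/2..} theta_tail"
    unfolding theta_tail_def [abs_def]
    by (rule uniform_limit_theorem[rotated]) (auto intro!: continuous_intros always_eventually)
  thus ?thesis
    by (rule continuous_on_interior) (use assms in auto)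
qed

lemma continuous_theta_tail_exp [continuous_intros]:
  "continuous_on A (\<lambda>u. theta_tail (exp u))"
proof (rule continuous_on_compose2[of "{0<..}" theta_tail])
  show "continuous_on {0<..} theta_tail"
    using isCont_theta_tail by (intro continuous_at_imp_continuous_on) auto
qed (auto intro!: continuous_intros)

lemma borel_measurable_theta_tail_exp [measurable]:
  "(\<lambda>u. theta_tail (exp u)) \<in> borel_measurable borel"
  by (intro borel_measurable_continuous_onI continuous_intros)

section \<open>Gamma integrals in the logarithmic variable\<close>

lemma exp_mult_minus_exp_ln:
  fixes z :: complex
  assumes "x > 0"
  shows "(1 / x) *\<^sub>R exp (z * of_real (ln x) - of_real (exp (ln x))) = of_real x powr (z - 1) / of_real (exp x)"
proof -
  have e: "exp (complex_of_real (ln x)) = of_real x"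
    using assms by (simp add: exp_of_real)
  hence "of_real x powr (z - 1) = exp (z * of_real (ln x)) / of_real x"
    using assms by (simp add: powr_def Ln_of_real exp_diff algebra_simps)
  thus ?thesis using assms
    by (simp add: exp_diff scaleR_conv_of_real exp_of_real)
qed

text \<open>With \<open>u = ln x\<close> Euler's integral runs over the whole line, where rescaling
  \<open>x\<close> becomes a translation and \<open>x \<mapsto> 1 / x\<close> a reflection.\<close>

lemma Gamma_integral_exp:
  assumes z: "Re z > 0"
  shows "has_bochner_integral lborel (\<lambda>u. exp (z * of_real u - of_real (exp u))) (Gamma z)"
proof -
  have *: "set_integrable lborel {0<..} (\<lambda>x. (1 / x) *\<^sub>R exp (w * of_real (ln x) - of_real (exp (ln x))))"
    if w: "Re w > 0" for w :: complex
  proof -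
    have "set_integrable lebesgue {0<..} (\<lambda>x. (1 / x) *\<^sub>R exp (w * of_real (ln x) - of_real (exp (ln x)))) \<longleftrightarrow>
          set_integrable lebesgue {0<..} (\<lambda>x. of_real x powr (w - 1) / of_real (exp x))"
      by (intro set_integrable_cong refl exp_mult_minus_exp_ln) simp
    with absolutely_integrable_Gamma_integral'[OF w]
    have "set_integrable lebesgue {0<..} (\<lambda>x. (1 / x) *\<^sub>R exp (w * of_real (ln x) - of_real (exp (ln x))))"
      by simp
    thus ?thesis
      unfolding set_integrable_def by (subst (asm) integrable_completion) auto
  qed
  have lim: "((ereal \<circ> ln \<circ> real_of_ereal) \<longlongrightarrow> - \<infinity>) (at_right 0)"
            "((ereal \<circ> ln \<circ> real_of_ereal) \<longlongrightarrow> \<infinity>) (at_left \<infinity>)"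
    using ln_at_0 ln_at_top by (simp_all add: zero_ereal_def ereal_tendsto_simps)
  have ei: "einterval 0 \<infinity> = {0<..}" by (auto simp: einterval_def)
  \<comment> \<open>The substitution rule for complex integrands presupposes integrability on both
    sides. On the side of \<open>u\<close> it comes from the rule for nonnegative functions, applied
    to the norm of the integrand.\<close>
  have nint: "set_integrable lborel (einterval (- \<infinity>) \<infinity>) (\<lambda>u. exp (Re z * u - exp u))"
  proof (rule interval_integral_substitution_nonneg(1)[where g = ln and g' = "\<lambda>x. 1 / x" and a = 0 and b = \<infinity>])
    have "set_integrable lborel {0<..} (\<lambda>x. norm ((1 / x) *\<^sub>R exp (z * of_real (ln x) - of_real (exp (ln x)))))"
      by (intro set_integrable_norm * z)
    thus "set_integrable lborel (einterval 0 \<infinity>) (\<lambda>x. exp (Re z * ln x - exp (ln x)) * (1 / x))"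
      unfolding ei by (rule set_integrable_cong[THEN iffD1, rotated -1]) auto
  qed (use lim in \<open>auto intro!: derivative_eq_intros continuous_intros simp: divide_inverse\<close>)
  have int: "integrable lborel (\<lambda>u. exp (z * of_real u - of_real (exp u)))"
  proof (rule Bochner_Integration.integrable_bound)
    show "integrable lborel (\<lambda>u. exp (Re z * u - exp u))"
      using nint by (simp add: set_integrable_def)
  qed auto
  have "(LBINT u=-\<infinity>..\<infinity>. exp (z * of_real u - of_real (exp u))) =
        (LBINT x=0..\<infinity>. (1 / x) *\<^sub>R exp (z * of_real (ln x) - of_real (exp (ln x))))"
    by (rule interval_integral_substitution_integrable[where g = ln])
       (use lim * z int in \<open>auto intro!: derivative_eq_intros continuous_intros simp: ei set_integrable_def divide_inverse\<close>)
  also have "\<dots> = (LBINT x:{0<..}. (1 / x) *\<^sub>R exp (z * of_real (ln x) - of_real (exp (ln x))))"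
    by (simp add: interval_lebesgue_integral_0_infty)
  also have "\<dots> = integral {0<..} (\<lambda>x. (1 / x) *\<^sub>R exp (z * of_real (ln x) - of_real (exp (ln x))))"
    by (intro set_borel_integral_eq_integral * z)
  also have "\<dots> = integral {0<..} (\<lambda>x. of_real x powr (z - 1) / of_real (exp x))"
    by (intro Henstock_Kurzweil_Integration.integral_cong) (use exp_mult_minus_exp_ln in auto)
  also have "\<dots> = Gamma z"
    using Gamma_integral_complex'[OF z] by (rule integral_unique)
  finally have "integral\<^sup>L lborel (\<lambda>u. exp (z * of_real u - of_real (exp u))) = Gamma z"
    by (simp add: interval_lebesgue_integral_def set_lebesgue_integral_def)
  with int show ?thesis by (simp add: has_bochner_integral_iff)
qed

text \<open>Multiplying \<open>exp u\<close> by \<open>c\<close> amounts to the translation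
  \<open>u \<mapsto> ln c + u\<close>, which costs the factor
  \<open>exp (- z * ln c)\<close>.\<close>

lemma Gamma_integral_exp_scaled:
  assumes "Re z > 0" "c > 0"
  shows "has_bochner_integral lborel (\<lambda>u. exp (z * of_real u - of_real (c * exp u))) (of_real c powr (-z) * Gamma z)"
proof -
  have "has_bochner_integral lborel (\<lambda>u. exp (z * of_real (ln c + 1 * u) - of_real (exp (ln c + 1 * u)))) (Gamma z /\<^sub>R \<bar>1\<bar>)"
    using Gamma_integral_exp[OF assms(1)] by (subst (asm) lborel_has_bochner_integral_real_affine_iff[of 1 _ _ "ln c"]) auto
  hence "has_bochner_integral lborel (\<lambda>u. of_real c powr (-z) * exp (z * of_real (ln c + 1 * u) - of_real (exp (ln c + 1 * u)))) (of_real c powr (-z) * Gamma z)"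
    by (intro has_bochner_integral_mult_right) auto
  also have "(\<lambda>u. of_real c powr (-z) * exp (z * of_real (ln c + 1 * u) - of_real (exp (ln c + 1 * u)))) =
             (\<lambda>u. exp (z * of_real u - of_real (c * exp u)))"
  proof
    fix u
    have 1: "exp (ln c + 1 * u) = c * exp u" using assms(2) by (simp add: exp_add)
    have 2: "of_real c powr (-z) = exp (- z * of_real (ln c))"
      using assms(2) by (simp add: powr_def Ln_of_real)
    show "of_real c powr (-z) * exp (z * of_real (ln c + 1 * u) - of_real (exp (ln c + 1 * u))) =
          exp (z * of_real u - of_real (c * exp u))"
      unfolding 1 2 exp_add [symmetric] by (simp add: algebra_simps)
  qed
  finally show ?thesis .
qed

text \<open>Integrability for every complex \<open>w\<close> is what makes
  \<open>theta_mellin\<close> entire. For \<open>u \<ge> 0\<close> the tail is at most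
  \<open>2 * exp (- pi * exp u)\<close>, so a Gamma integrand dominates. Its parameter
  \<open>R\<close> is at least \<open>Re w\<close>, and positive as the Gamma integral
  requires.\<close>

lemma set_integrable_exp_theta_tail:
  "set_integrable lborel {0..} (\<lambda>u. exp (w * of_real u) * complex_of_real (theta_tail (exp u)))"
proof -
  define R where "R = \<bar>Re w\<bar> + 1"
  have "integrable lborel (\<lambda>u. exp (of_real R * of_real u - complex_of_real (pi * exp u)))"
    using Gamma_integral_exp_scaled[of "of_real R" pi]
    by (simp only: has_bochner_integral_iff) (simp add: R_def)
  hence "integrable lborel (\<lambda>u. norm (exp (of_real R * of_real u - complex_of_real (pi * exp u))))"
    by (rule integrable_norm)
  hence "integrable lborel (\<lambda>u. 2 * exp (R * u - pi * exp u))"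
    by (intro integrable_mult_right) simp
  thus ?thesis unfolding set_integrable_def
  proof (rule Bochner_Integration.integrable_bound)
    show "AE u in lborel. norm (indicat_real {0..} u *\<^sub>R (exp (w * of_real u) * complex_of_real (theta_tail (exp u))))
             \<le> norm (2 * exp (R * u - pi * exp u))"
    proof (intro AE_I2)
      fix u :: real
      show "norm (indicat_real {0..} u *\<^sub>R (exp (w * of_real u) * complex_of_real (theta_tail (exp u))))
             \<le> norm (2 * exp (R * u - pi * exp u))"
      proof (cases "u \<ge> 0")
        case True
        have "Re w * u \<le> R * u" using True by (intro mult_right_mono) (auto simp: R_def)
        hence "exp (Re w * u) * theta_tail (exp u) \<le> exp (R * u) * (2 * exp (- pi * exp u))"
          using True by (intro mult_mono theta_tail_le theta_tail_nonneg) auto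
        thus ?thesis using True theta_tail_nonneg[of "exp u"]
          by (simp add: norm_mult exp_diff exp_minus field_simps)
      qed auto
    qed
  qed measurable
qed

text \<open>
  Half of the Mellin transform of the theta function, in the logarithmic variable \<open>x = exp u\<close>:
  there the inversion \<open>x \<mapsto> 1 / x\<close> becomes \<open>u \<mapsto> - u\<close>.
\<close>

definition theta_mellin :: "complex \<Rightarrow> complex" where
  "theta_mellin s = (LBINT u:{0..}. exp (s / 2 * of_real u) * of_real (theta_tail (exp u)))"

text \<open>The integrals over \<open>[0, N]\<close> are holomorphic by differentiation under the
  integral sign. They converge uniformly on the unit disk around \<open>s\<close>, because there
  \<open>Re z / 2 \<le> R\<close> and a single integrable function \<open>G\<close> dominates all
  tails.\<close>

lemma holomorphic_theta_mellin: "theta_mellin holomorphic_on UNIV"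
proof (rule holomorphic_uniform_sequence[where f = "\<lambda>N s. integral (cbox 0 (real N)) (\<lambda>u. exp (s / 2 * of_real u) * of_real (theta_tail (exp u)))"])
  fix N
  show "(\<lambda>s. integral (cbox 0 (real N)) (\<lambda>u. exp (s / 2 * of_real u) * complex_of_real (theta_tail (exp u)))) holomorphic_on UNIV"
  proof (rule leibniz_rule_holomorphic[where fx = "\<lambda>s u. exp (s / 2 * of_real u) * (of_real u / 2) * of_real (theta_tail (exp u))"])
    show "continuous_on (UNIV \<times> cbox 0 (real N)) (\<lambda>(s, u). exp (s / 2 * of_real u) * (of_real u / 2) * complex_of_real (theta_tail (exp u)))"
      unfolding case_prod_beta
      by (intro continuous_intros continuous_on_compose2[OF continuous_theta_tail_exp[of UNIV] continuous_on_snd]) auto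
  qed (auto intro!: derivative_eq_intros integrable_continuous_real continuous_intros)
next
  fix s :: complex
  define R where "R = (\<bar>Re s\<bar> + 1) / 2"
  define G where "G u = indicat_real {0..} u * (exp (R * u) * theta_tail (exp u))" for u
  have G: "integrable lborel G"
  proof -
    have "set_integrable lborel {0..} (\<lambda>u. norm (exp (of_real R * of_real u) * complex_of_real (theta_tail (exp u))))"
      by (intro set_integrable_norm set_integrable_exp_theta_tail)
    also have "?this \<longleftrightarrow> set_integrable lborel {0..} (\<lambda>u. exp (R * u) * theta_tail (exp u))"
      by (intro set_integrable_cong) (auto simp: norm_mult theta_tail_nonneg)
    finally show ?thesis by (simp add: set_integrable_def G_def [abs_def])
  qed
  have diff: "norm (theta_mellin z - integral (cbox 0 (real N)) (\<lambda>u. exp (z / 2 * of_real u) * of_real (theta_tail (exp u))))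
           \<le> integral\<^sup>L lborel G - (\<integral>u. indicat_real {..real N} u *\<^sub>R G u \<partial>lborel)"
    if z: "z \<in> cball s 1" for z N
  proof -
    let ?f = "\<lambda>u. exp (z / 2 * of_real u) * complex_of_real (theta_tail (exp u))"
    have int0: "set_integrable lborel {0..} ?f" by (rule set_integrable_exp_theta_tail)
    have intN: "set_integrable lborel {0..real N} ?f" by (rule set_integrable_subset[OF int0]) auto
    have intG: "integrable lborel (\<lambda>u. indicat_real {..real N} u *\<^sub>R G u)"
      by (intro integrable_mult_indicator G) auto
    have "Re z \<le> Re s + 1"
      using z abs_Re_le_cmod[of "s - z"] by (auto simp: dist_norm)
    hence Re: "Re z / 2 \<le> R" unfolding R_def by (intro divide_right_mono) linarith+
    have "theta_mellin z - integral (cbox 0 (real N)) ?f = (LBINT u:{0..}. ?f u) - (LBINT u:{0..real N}. ?f u)"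
      using set_borel_integral_eq_integral(2)[OF intN] by (simp add: theta_mellin_def)
    also have "\<dots> = (\<integral>u. indicat_real {0..} u *\<^sub>R ?f u - indicat_real {0..real N} u *\<^sub>R ?f u \<partial>lborel)"
      using int0 intN unfolding set_lebesgue_integral_def set_integrable_def
      by (intro Bochner_Integration.integral_diff [symmetric])
    also have "norm \<dots> \<le> (\<integral>u. G u - indicat_real {..real N} u *\<^sub>R G u \<partial>lborel)"
    proof (rule Bochner_Integration.integral_norm_bound_integral)
      fix u :: real
      have "exp (Re z / 2 * u) * theta_tail (exp u) \<le> exp (R * u) * theta_tail (exp u)" if "u \<ge> 0"
      proof -
        have "Re z / 2 * u \<le> R * u" using that Re by (intro mult_right_mono)
        thus ?thesis by (intro mult_right_mono theta_tail_nonneg) auto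
      qed
      thus "norm (indicat_real {0..} u *\<^sub>R ?f u - indicat_real {0..real N} u *\<^sub>R ?f u) \<le> G u - indicat_real {..real N} u *\<^sub>R G u"
        by (auto simp: G_def indicator_def norm_mult theta_tail_nonneg)
    qed (use int0 intN G intG in \<open>auto simp: set_integrable_def\<close>)
    also have "\<dots> = integral\<^sup>L lborel G - (\<integral>u. indicat_real {..real N} u *\<^sub>R G u \<partial>lborel)"
      by (intro Bochner_Integration.integral_diff G intG)
    finally show ?thesis .
  qed
  have "(\<lambda>N. integral\<^sup>L lborel G - (\<integral>u. indicat_real {..real N} u *\<^sub>R G u \<partial>lborel)) \<longlonglongrightarrow> integral\<^sup>L lborel G - integral\<^sup>L lborel G"
    by (intro tendsto_intros filterlim_compose[OF tendsto_integral_at_top[OF sets_lborel G] filterlim_real_sequentially])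
  hence lim0: "(\<lambda>N. integral\<^sup>L lborel G - (\<integral>u. indicat_real {..real N} u *\<^sub>R G u \<partial>lborel)) \<longlonglongrightarrow> 0" by simp
  have "uniform_limit (cball s 1) (\<lambda>N z. integral (cbox 0 (real N)) (\<lambda>u. exp (z / 2 * of_real u) * of_real (theta_tail (exp u)))) theta_mellin sequentially"
  proof (rule uniform_limitI)
    fix e :: real assume "e > 0"
    have "eventually (\<lambda>N. integral\<^sup>L lborel G - (\<integral>u. indicat_real {..real N} u *\<^sub>R G u \<partial>lborel) < e) sequentially"
      using lim0 \<open>e > 0\<close> by (rule order_tendstoD)
    thus "eventually (\<lambda>N. \<forall>z\<in>cball s 1. dist (integral (cbox 0 (real N)) (\<lambda>u. exp (z / 2 * of_real u) * of_real (theta_tail (exp u)))) (theta_mellin z) < e) sequentially"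
    proof eventually_elim
      case (elim N)
      show ?case
      proof
        fix z assume "z \<in> cball s 1"
        from le_less_trans[OF diff[OF this] elim]
        show "dist (integral (cbox 0 (real N)) (\<lambda>u. exp (z / 2 * of_real u) * of_real (theta_tail (exp u)))) (theta_mellin z) < e"
          by (simp only: dist_norm norm_minus_commute)
      qed
    qed
  qed
  thus "\<exists>d>0. cball s d \<subseteq> UNIV \<and> uniform_limit (cball s d) (\<lambda>N z. integral (cbox 0 (real N)) (\<lambda>u. exp (z / 2 * of_real u) * of_real (theta_tail (exp u)))) theta_mellin sequentially"
    by (intro exI[of _ 1]) auto
qed auto

section \<open>Riemann's decomposition of the completed zeta function\<close>

lemma set_integral_exp_neg:
  fixes w :: complex
  assumes w: "Re w > 0"
  shows "set_integrable lborel {0..} (\<lambda>u. exp (- w * of_real u))"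
    and "(LBINT u:{0..}. exp (- w * of_real u)) = 1 / w"
proof -
  have "set_integrable lborel {0..} (\<lambda>u. exp (- Re w * u))"
  proof -
    have "set_integrable lebesgue {0..} (\<lambda>u. exp (- Re w * u))"
      using integrable_on_exp_minus_to_infinity[OF w, of 0]
      by (intro nonnegative_absolutely_integrable_1) auto
    thus ?thesis unfolding set_integrable_def by (subst (asm) integrable_completion) auto
  qed
  thus int: "set_integrable lborel {0..} (\<lambda>u. exp (- w * of_real u))"
    by (rule set_integrable_bound) (auto simp: set_borel_measurable_def)
  have w0: "w \<noteq> 0" using w by auto
  have "(LBINT u=ereal 0..\<infinity>. exp (- w * of_real u)) = 0 - (- 1 / w)"
  proof (rule interval_integral_FTC_integrable[where F = "\<lambda>u. - exp (- w * of_real u) / w"])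
    show "((\<lambda>u. - exp (- w * complex_of_real u) / w) has_vector_derivative exp (- w * of_real x)) (at x)" for x
      using w0 by (auto intro!: derivative_eq_intros has_vector_derivative_real_field)
    show "set_integrable lborel (einterval (ereal 0) \<infinity>) (\<lambda>u. exp (- w * of_real u))"
      using int by (rule set_integrable_subset) auto
    have "((\<lambda>u. - exp (- w * complex_of_real u) / w) \<longlongrightarrow> - exp (- w * complex_of_real 0) / w) (at_right 0)"
      by (intro tendsto_intros w0)
    thus "(((\<lambda>u. - exp (- w * complex_of_real u) / w) \<circ> real_of_ereal) \<longlongrightarrow> - 1 / w) (at_right (ereal 0))"
      by (simp add: ereal_tendsto_simps)
    have "((\<lambda>u. exp (- w * complex_of_real u)) \<longlongrightarrow> 0) at_top"
    proof (rule tendsto_norm_zero_cancel)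
      have "filterlim (\<lambda>u. - (Re w * u)) at_bot at_top"
        using w by real_asymp
      thus "((\<lambda>u. norm (exp (- w * complex_of_real u))) \<longlongrightarrow> 0) at_top"
        using filterlim_compose[OF exp_at_bot] by simp
    qed
    from tendsto_divide[OF tendsto_minus[OF this] tendsto_const w0]
    show "(((\<lambda>u. - exp (- w * complex_of_real u) / w) \<circ> real_of_ereal) \<longlongrightarrow> 0) (at_left \<infinity>)"
      by (simp add: ereal_tendsto_simps)
  qed (auto intro!: continuous_intros)
  also have "(LBINT u=ereal 0..\<infinity>. exp (- w * of_real u)) = (LBINT u:{0<..}. exp (- w * of_real u))"
    by (simp add: interval_integral_to_infinity_eq)
  also have "\<dots> = (LBINT u:{0..}. exp (- w * of_real u))"
  proof (unfold set_lebesgue_integral_def, rule integral_cong_AE)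
    show "AE u in lborel. indicat_real {0<..} u *\<^sub>R exp (- w * of_real u) = indicat_real {0..} u *\<^sub>R exp (- w * of_real u)"
      using AE_lborel_singleton[of "0::real"] by eventually_elim (auto simp: indicator_def)
  qed auto
  finally show "(LBINT u:{0..}. exp (- w * of_real u)) = 1 / w" by simp
qed

lemma summable_zeta_series:
  assumes "Re s > 1"
  shows "summable (\<lambda>n. 1 / of_nat (Suc n) powr s)"
    and "summable (\<lambda>n. real (Suc n) powr (- Re s))"
proof -
  have "summable (\<lambda>n. exp (of_real (ln (real (Suc n))) * (- s)))"
    using assms by (subst summable_Suc_iff, intro summable_complex_powr_iff) auto
  also have "(\<lambda>n. exp (of_real (ln (real (Suc n))) * (- s))) = (\<lambda>n. 1 / of_nat (Suc n) powr s)"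
  proof
    fix n
    have "Ln (of_nat (Suc n)) = of_real (ln (real (Suc n)))"
      by (subst of_real_of_nat_eq [symmetric], subst Ln_of_real) simp_all
    thus "exp (of_real (ln (real (Suc n))) * (- s)) = 1 / of_nat (Suc n) powr s"
      by (simp add: powr_def exp_minus field_simps del: of_nat_Suc)
  qed
  finally show "summable (\<lambda>n. 1 / of_nat (Suc n) powr s)" .
  have "summable (\<lambda>n. real n powr (- Re s))" using assms by (subst summable_real_powr_iff) auto
  thus "summable (\<lambda>n. real (Suc n) powr (- Re s))" by (subst summable_Suc_iff)
qed

text \<open>Termwise integration: the \<open>n\<close>-th exponential of the theta series gives a
  Gamma integral with scale \<open>pi * (n + 1)^2\<close>, hence the \<open>n\<close>-th term of the
  Dirichlet series. The interchange rests on absolute summability, which is where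
  \<open>Re s > 1\<close> enters.\<close>

lemma mellin_transform_theta_tail:
  assumes s: "Re s > 1"
  shows "has_bochner_integral lborel (\<lambda>u. exp (s / 2 * of_real u) * of_real (theta_tail (exp u)))
           (of_real pi powr (- s / 2) * Gamma (s / 2) * (\<Sum>n. 1 / of_nat (Suc n) powr s))"
proof -
  define c where "c n = pi * (real (Suc n))\<^sup>2" for n
  have c: "c n > 0" for n by (simp add: c_def)
  define f where "f n u = exp (s / 2 * of_real u - of_real (c n * exp u))" for n u
  have bi: "has_bochner_integral lborel (f n) (of_real (c n) powr (- (s / 2)) * Gamma (s / 2))" for n
    unfolding f_def using s c by (intro Gamma_integral_exp_scaled) auto
  have c_powr: "of_real (c n) powr (- (w / 2)) = of_real pi powr (- w / 2) * (1 / of_nat (Suc n) powr w)" for n and w :: complex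
  proof -
    have L1: "Ln (complex_of_real (c n)) = of_real (ln pi) + 2 * of_real (ln (real (Suc n)))"
      by (subst Ln_of_real[OF c]) (simp add: c_def ln_mult ln_realpow del: of_nat_Suc)
    have L2: "Ln (of_nat (Suc n)) = of_real (ln (real (Suc n)))"
      by (subst of_real_of_nat_eq [symmetric], subst Ln_of_real) simp_all
    have L3: "Ln (of_real pi) = of_real (ln pi)" by (rule Ln_of_real) simp
    have "exp (- (w / 2) * (a + 2 * b)) = exp (- w / 2 * a) * (1 / exp (w * b))" for a b :: complex
      unfolding inverse_eq_divide [symmetric] exp_minus [symmetric] exp_add [symmetric]
      by (simp add: algebra_simps)
    thus ?thesis using c[of n] by (simp add: powr_def L1 L2 L3 del: of_nat_Suc)
  qed
  \<comment> \<open>The norm is the same integrand with \<open>Re s\<close> in place of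
    \<open>s\<close>, so its integral is given by the same formula.\<close>
  have norm_f: "norm (f n u) = Re (exp (of_real (Re s) / 2 * of_real u - of_real (c n * exp u)))" for n u
    by (simp add: f_def Re_exp)
  have norm_bi: "has_bochner_integral lborel (\<lambda>u. norm (f n u)) (Re (of_real (c n) powr (- (of_real (Re s) / 2)) * Gamma (of_real (Re s) / 2)))" for n
    unfolding norm_f using s c by (intro has_bochner_integral_Re Gamma_integral_exp_scaled) auto
  have norm_int: "(\<integral>u. norm (f n u) \<partial>lborel) = pi powr (- Re s / 2) * Gamma (Re s / 2) * real (Suc n) powr (- Re s)" for n
  proof -
    have "(real (Suc n))\<^sup>2 powr (- (Re s / 2)) = real (Suc n) powr (- Re s)"
      by (simp add: powr_powr del: of_nat_Suc flip: powr_numeral)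
    hence "c n powr (- (Re s / 2)) = pi powr (- Re s / 2) * real (Suc n) powr (- Re s)"
      by (simp add: c_def powr_mult del: of_nat_Suc)
    moreover have "of_real (c n) powr (- (of_real (Re s) / 2)) * Gamma (of_real (Re s) / 2) =
       complex_of_real (c n powr (- (Re s / 2)) * Gamma (Re s / 2))"
    proof -
      have "of_real (c n) powr (of_real (- (Re s / 2))) = complex_of_real (c n powr (- (Re s / 2)))"
        using c[of n] by (intro powr_of_real) auto
      moreover have "Gamma (complex_of_real (Re s / 2)) = of_real (Gamma (Re s / 2))"
        by (rule Gamma_complex_of_real)
      ultimately show ?thesis by simp
    qed
    ultimately show ?thesis using norm_bi[of n] by (simp add: has_bochner_integral_iff mult_ac)
  qed
  have sum_f: "(\<lambda>n. f n u) sums (exp (s / 2 * of_real u) * of_real (theta_tail (exp u)))" for u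
  proof -
    have "(\<lambda>n. exp (- pi * (real (Suc n))\<^sup>2 * exp u)) sums theta_tail (exp u)"
      unfolding theta_tail_def by (intro summable_sums theta_tail_summable) auto
    hence "(\<lambda>n. exp (s / 2 * of_real u) * of_real (exp (- pi * (real (Suc n))\<^sup>2 * exp u))) sums (exp (s / 2 * of_real u) * of_real (theta_tail (exp u)))"
      by (intro sums_mult sums_of_real)
    also have "(\<lambda>n. exp (s / 2 * of_real u) * of_real (exp (- pi * (real (Suc n))\<^sup>2 * exp u))) = (\<lambda>n. f n u)"
      unfolding f_def c_def exp_of_real [symmetric] exp_add [symmetric] by (simp add: algebra_simps)
    finally show ?thesis .
  qed
  have int_f: "integrable lborel (f n)" for n using bi[of n] by (simp add: has_bochner_integral_iff)
  have summ: "AE u in lborel. summable (\<lambda>n. norm (f n u))"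
  proof (intro AE_I2)
    fix u :: real
    have "summable (\<lambda>n. exp (Re s / 2 * u) * exp (- pi * (real (Suc n))\<^sup>2 * exp u))"
      by (intro summable_mult theta_tail_summable) auto
    thus "summable (\<lambda>n. norm (f n u))"
      unfolding exp_add [symmetric] by (simp add: f_def c_def algebra_simps)
  qed
  have sums: "summable (\<lambda>n. \<integral>u. norm (f n u) \<partial>lborel)"
    unfolding norm_int by (intro summable_mult summable_zeta_series s)
  have eq: "(\<lambda>u. \<Sum>n. f n u) = (\<lambda>u. exp (s / 2 * of_real u) * of_real (theta_tail (exp u)))"
    using sum_f by (auto simp: sums_iff)
  have "integral\<^sup>L lborel (f n) = of_real pi powr (- s / 2) * Gamma (s / 2) * (1 / of_nat (Suc n) powr s)" for n
    using bi[of n] c_powr[of n s] by (simp add: has_bochner_integral_iff)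
  hence "(\<Sum>n. integral\<^sup>L lborel (f n)) = of_real pi powr (- s / 2) * Gamma (s / 2) * (\<Sum>n. 1 / of_nat (Suc n) powr s)"
    by (simp only: suminf_mult [OF summable_zeta_series(1)[OF s]])
  with integrable_suminf[OF int_f summ sums] integral_suminf[OF int_f summ sums]
  show ?thesis by (simp add: has_bochner_integral_iff eq)
qed

text \<open>The negative half-line is reflected onto the positive one, where theta inversion returns
  the tail at \<open>exp u\<close> plus elementary exponentials; these integrate to the polar terms.
  The right-hand side makes sense for all \<open>s\<close> other than \<open>0\<close> and
  \<open>1\<close> and is symmetric under \<open>s \<mapsto> 1 - s\<close>. Multiplied by
  \<open>s * (1 - s)\<close>, the polar terms become the constant \<open>- 1\<close> in
  \<open>riemann_xi\<close>.\<close>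

lemma completed_zeta_decomposition:
  assumes s: "Re s > 1"
  shows "of_real pi powr (- s / 2) * Gamma (s / 2) * (\<Sum>n. 1 / of_nat (Suc n) powr s) =
           theta_mellin s + theta_mellin (1 - s) + 1 / (s - 1) - 1 / s"
proof -
  define F where "F u = exp (s / 2 * of_real u) * complex_of_real (theta_tail (exp u))" for u
  define G where "G u = exp ((1 - s) / 2 * of_real u) * of_real (theta_tail (exp u)) +
    (exp (- ((s - 1) / 2) * of_real u) - exp (- (s / 2) * of_real u)) / 2" for u
  have F: "has_bochner_integral lborel F (of_real pi powr (- s / 2) * Gamma (s / 2) * (\<Sum>n. 1 / of_nat (Suc n) powr s))"
    using mellin_transform_theta_tail[OF s] unfolding F_def [abs_def] .
  hence intF: "integrable lborel F" by (simp add: has_bochner_integral_iff)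
  have FG: "F (- u) = G u" for u
  proof -
    have "sqrt (exp u) = exp (u / 2)" 
      by (rule real_sqrt_unique) (simp_all add: power2_eq_square flip: exp_add)
    hence "exp (u / 2) * (1 + 2 * theta_tail (exp u)) = 1 + 2 * theta_tail (exp (- u))"
      using theta_tail_inversion[of "exp u"] by (simp add: exp_minus inverse_eq_divide)
    \<comment> \<open>The constant terms \<open>1\<close> of the two theta functions leave
      \<open>(exp (u / 2) - 1) / 2\<close>, the origin of the polar terms.\<close>
    hence "theta_tail (exp (- u)) = exp (u / 2) * theta_tail (exp u) + (exp (u / 2) - 1) / 2"
      by (simp add: field_simps)
    hence "F (- u) = exp (- (s / 2) * of_real u) * (exp (of_real u / 2) * of_real (theta_tail (exp u)) + (exp (of_real u / 2) - 1) / 2)"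
      by (simp add: F_def exp_of_real [symmetric])
    also have "\<dots> = exp (- (s / 2) * of_real u + of_real u / 2) * of_real (theta_tail (exp u)) + (exp (- (s / 2) * of_real u + of_real u / 2) - exp (- (s / 2) * of_real u)) / 2"
      by (simp only: exp_add) (simp add: algebra_simps diff_divide_distrib)
    also have "- (s / 2) * of_real u + of_real u / 2 = (1 - s) / 2 * of_real u" by (simp add: algebra_simps diff_divide_distrib)
    also have "(1 - s) / 2 * of_real u = - ((s - 1) / 2) * complex_of_real u" by (simp add: algebra_simps diff_divide_distrib)
    finally show ?thesis by (simp only: G_def \<open>(1 - s) / 2 * of_real u = - ((s - 1) / 2) * complex_of_real u\<close>)
  qed
  have int1: "set_integrable lborel {0..} (\<lambda>u. exp ((1 - s) / 2 * of_real u) * complex_of_real (theta_tail (exp u)))"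
    by (rule set_integrable_exp_theta_tail)
  have int2: "set_integrable lborel {0..} (\<lambda>u. exp (- ((s - 1) / 2) * of_real u))"
    "set_integrable lborel {0..} (\<lambda>u. exp (- (s / 2) * of_real u))"
    using s by (intro set_integral_exp_neg(1); simp)+
  have "integral\<^sup>L lborel F = (\<integral>u. indicat_real {0..} u *\<^sub>R F u + indicat_real {..<0} u *\<^sub>R F u \<partial>lborel)"
    by (intro Bochner_Integration.integral_cong) (auto simp: indicator_def)
  also have "\<dots> = (\<integral>u. indicat_real {0..} u *\<^sub>R F u \<partial>lborel) + (\<integral>u. indicat_real {..<0} u *\<^sub>R F u \<partial>lborel)"
    by (intro Bochner_Integration.integral_add integrable_mult_indicator intF) auto
  also have "(\<integral>u. indicat_real {0..} u *\<^sub>R F u \<partial>lborel) = theta_mellin s"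
    by (simp add: theta_mellin_def F_def set_lebesgue_integral_def)
  also have "(\<integral>u. indicat_real {..<0} u *\<^sub>R F u \<partial>lborel) = (\<integral>u. indicat_real {0<..} u *\<^sub>R G u \<partial>lborel)"
    by (subst lborel_integral_real_affine[of "-1" _ 0])
       (auto simp: FG indicator_def intro!: Bochner_Integration.integral_cong)
  also have "\<dots> = (LBINT u:{0..}. G u)"
  proof (unfold set_lebesgue_integral_def, rule integral_cong_AE)
    show "AE u in lborel. indicat_real {0<..} u *\<^sub>R G u = indicat_real {0..} u *\<^sub>R G u"
      using AE_lborel_singleton[of "0::real"] by eventually_elim (auto simp: indicator_def)
  qed (auto simp: G_def)
  also have "\<dots> = theta_mellin (1 - s) + ((LBINT u:{0..}. exp (- ((s - 1) / 2) * of_real u)) - (LBINT u:{0..}. exp (- (s / 2) * of_real u))) / 2"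
    unfolding G_def theta_mellin_def using int1 int2
    by (simp add: set_integral_add set_integral_diff set_integral_divide_zero)
  also have "((LBINT u:{0..}. exp (- ((s - 1) / 2) * of_real u)) - (LBINT u:{0..}. exp (- (s / 2) * of_real u))) / 2 = 1 / (s - 1) - 1 / s"
    using s by (subst (1 2) set_integral_exp_neg) (simp_all add: diff_divide_distrib)
  finally have "integral\<^sup>L lborel F = theta_mellin s + (theta_mellin (1 - s) + (1 / (s - 1) - 1 / s))" .
  moreover have "integral\<^sup>L lborel F = of_real pi powr (- s / 2) * Gamma (s / 2) * (\<Sum>n. 1 / of_nat (Suc n) powr s)"
    using F by (simp only: has_bochner_integral_iff)
  ultimately show ?thesis by (simp only: add_diff_eq add.assoc)
qed

section \<open>The entire xi function and the continuation of zeta\<close>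

definition riemann_xi :: "complex \<Rightarrow> complex" where
  "riemann_xi s = (s * (1 - s) * (theta_mellin s + theta_mellin (1 - s)) - 1) / 2"

text \<open>At the pole \<open>1\<close> the division by zero yields the value \<open>0\<close> that the definition of \<open>zeta\<close> demands.\<close>

definition riemann_zeta :: "complex \<Rightarrow> complex" where
  "riemann_zeta s = riemann_xi s * (of_real pi powr (s / 2) * rGamma (s / 2 + 1)) / (1 - s)"

lemma riemann_xi_symmetric: "riemann_xi (1 - s) = riemann_xi s"
  by (simp add: riemann_xi_def algebra_simps)

lemma riemann_xi_0: "riemann_xi 0 = -1/2" and riemann_xi_1: "riemann_xi 1 = -1/2"
  by (simp_all add: riemann_xi_def)

lemma holomorphic_riemann_xi: "riemann_xi holomorphic_on A"
proof -
  have 1: "theta_mellin holomorphic_on B" for B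
    by (rule holomorphic_on_subset[OF holomorphic_theta_mellin]) auto
  hence "(theta_mellin \<circ> (\<lambda>s. 1 - s)) holomorphic_on A"
    by (intro holomorphic_on_compose holomorphic_intros)
  hence 2: "(\<lambda>s. theta_mellin (1 - s)) holomorphic_on A" by (simp add: o_def)
  show ?thesis unfolding riemann_xi_def [abs_def]
    by (intro holomorphic_intros 1 2) auto
qed

lemma analytic_riemann_xi: "riemann_xi analytic_on A"
  using holomorphic_riemann_xi[of UNIV] by (metis analytic_on_open analytic_on_subset open_UNIV subset_UNIV)

lemma zeta_series_sums_riemann_zeta:
  assumes s: "Re s > 1"
  shows "(\<lambda>n. 1 / of_nat (Suc n) powr s) sums riemann_zeta s"
proof -
  define Z where "Z = (\<Sum>n. 1 / of_nat (Suc n) powr s)"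
  have s0: "s \<noteq> 0" "s \<noteq> 1" "s / 2 \<notin> \<int>\<^sub>\<le>\<^sub>0"
    using s by (auto elim!: nonpos_Ints_cases simp: complex_eq_iff)
  have "s * (1 - s) * (of_real pi powr (- s / 2) * Gamma (s / 2) * Z) = 2 * riemann_xi s"
    unfolding Z_def completed_zeta_decomposition[OF s] riemann_xi_def
    using s0 by (simp add: field_simps)
  hence xi: "riemann_xi s = s * (1 - s) * (of_real pi powr (- s / 2) * Gamma (s / 2) * Z) / 2" by simp
  have 1: "complex_of_real pi powr (- s / 2) * of_real pi powr (s / 2) = 1"
    by (simp add: powr_minus minus_divide_left [symmetric])
  \<comment> \<open>Absorbing the factor \<open>s / 2\<close> into the Gamma factor is the reason
    for the shifted argument in \<open>riemann_zeta\<close>: the formula has no singularity at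
    \<open>0\<close>.\<close>
  have 2: "s / 2 * Gamma (s / 2) * rGamma (s / 2 + 1) = 1"
    using rGamma_plus1[of "s / 2"] s0 by (simp add: rGamma_inverse_Gamma Gamma_eq_zero_iff field_simps)
  have "riemann_xi s * (of_real pi powr (s / 2) * rGamma (s / 2 + 1)) =
          (1 - s) * (complex_of_real pi powr (- s / 2) * of_real pi powr (s / 2)) *
          (s / 2 * Gamma (s / 2) * rGamma (s / 2 + 1)) * Z"
    unfolding xi by (simp add: mult_ac)
  also have "\<dots> = (1 - s) * Z" unfolding 1 2 by simp
  finally have "riemann_zeta s = Z" using s0 by (simp add: riemann_zeta_def)
  thus ?thesis
    using summable_zeta_series(1)[OF s] by (simp add: Z_def sums_iff)
qed

text \<open>The terms are positive and the first one is \<open>1\<close>. This is applied at the odd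
  integers from \<open>3\<close> on, to keep the trivial zeros simple, and at \<open>8\<close>, to
  see that \<open>xi\<close> is not constant.\<close>

lemma norm_riemann_zeta_real_ge_1:
  assumes "x > 1"
  shows "norm (riemann_zeta (of_real x)) \<ge> 1"
proof -
  have eq: "1 / of_nat (Suc n) powr complex_of_real x = of_real (1 / real (Suc n) powr x)" for n
  proof -
    have "of_nat (Suc n) powr complex_of_real x = complex_of_real (real (Suc n) powr x)"
      by (subst of_real_of_nat_eq [symmetric], rule powr_of_real) simp
    thus ?thesis by simp
  qed
  have sums: "(\<lambda>n. complex_of_real (1 / real (Suc n) powr x)) sums riemann_zeta (of_real x)"
    using zeta_series_sums_riemann_zeta[of "of_real x"] assms unfolding eq by simp
  have Re: "(\<lambda>n. 1 / real (Suc n) powr x) sums Re (riemann_zeta (of_real x))"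
    using sums_Re[OF sums] by simp
  have "(\<Sum>n<1. 1 / real (Suc n) powr x) \<le> Re (riemann_zeta (of_real x))"
    using Re by (intro sum_le_suminf[of "\<lambda>n. 1 / real (Suc n) powr x", THEN order.trans]) (auto simp: sums_iff)
  thus ?thesis using complex_Re_le_cmod[of "riemann_zeta (of_real x)"] by simp
qed

text \<open>The numerator is entire and nonzero at \<open>1\<close>, since
  \<open>riemann_xi 1 = - 1 / 2\<close> and the reciprocal Gamma function does not vanish at
  \<open>3 / 2\<close>. So the only singularity, that of \<open>1 / (1 - s)\<close>, is a genuine
  pole.\<close>

lemma riemann_zeta_nicely_meromorphic: "riemann_zeta nicely_meromorphic_on UNIV"
  and is_pole_riemann_zeta_iff: "is_pole riemann_zeta s \<longleftrightarrow> s = 1"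
proof -
  have hol: "(\<lambda>s. riemann_xi s * (of_real pi powr (s / 2) * rGamma (s / 2 + 1))) holomorphic_on A" for A
    by (intro holomorphic_intros holomorphic_riemann_xi) auto
  have ana: "riemann_zeta analytic_on - {1}"
    unfolding riemann_zeta_def [abs_def]
    by (subst analytic_on_open) (auto intro!: holomorphic_on_divide hol holomorphic_intros)
  have "(3 / 2 :: complex) \<notin> \<int>\<^sub>\<le>\<^sub>0"
    by (auto elim!: nonpos_Ints_cases simp: complex_eq_iff)
  hence "rGamma (3 / 2 :: complex) \<noteq> 0" by (rule rGamma_nonzero)
  hence pole: "is_pole riemann_zeta 1"
    unfolding riemann_zeta_def [abs_def]
  proof (intro is_pole_divide)
    show "isCont (\<lambda>s. riemann_xi s * (of_real pi powr (s / 2) * rGamma (s / 2 + 1))) 1"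
      using holomorphic_on_imp_continuous_on[OF hol[of UNIV]] continuous_on_eq_continuous_at[OF open_UNIV] by blast
    show "filterlim ((-) 1) (at 0) (at (1::complex))"
      by (rule filterlim_atI) (auto intro!: tendsto_eq_intros simp: eventually_at_filter)
  qed (auto simp: riemann_xi_1)
  have ana': "riemann_zeta analytic_on {s}" if "s \<noteq> 1" for s
    by (rule analytic_on_subset[OF ana]) (use that in auto)
  show "is_pole riemann_zeta s \<longleftrightarrow> s = 1"
    using pole analytic_at_imp_no_pole[OF ana'] by blast
  show "riemann_zeta nicely_meromorphic_on UNIV"
  proof (rule nicely_meromorphic_onI_open[where pts = "{1}"])
    fix s :: complex
    show "isolated_singularity_at riemann_zeta s"
    proof (cases "s = 1")
      case True
      have "riemann_zeta analytic_on ball 1 1 - {1}"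
        by (rule analytic_on_subset[OF ana]) auto
      with True show ?thesis unfolding isolated_singularity_at_def by (intro exI[of _ 1]) auto
    qed (intro isolated_singularity_at_analytic ana')
  qed (use pole ana in \<open>auto simp: riemann_zeta_def Compl_eq_Diff_UNIV\<close>)
qed

text \<open>Removing the singularities of the difference gives a function whose zeros accumulate at
  \<open>z0\<close>, hence the zero function. So \<open>f\<close> and \<open>g\<close> agree near
  every point except perhaps at the point itself, and there the normalisation of values
  decides.\<close>

lemma nicely_meromorphic_eqI:
  assumes f: "f nicely_meromorphic_on UNIV" and g: "g nicely_meromorphic_on UNIV"
    and eq: "eventually (\<lambda>w. f w = g w) (at z0)"
  shows "f = g"
proof
  fix z
  define h where "h w = f w - g w" for w
  have mf: "f meromorphic_on UNIV" and mg: "g meromorphic_on UNIV"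
    using f g by (auto simp: nicely_meromorphic_on_def)
  hence mh: "h meromorphic_on UNIV" unfolding h_def [abs_def] by (intro meromorphic_intros)
  have iso: "isolated_singularity_at h w" for w
    using mh by (meson UNIV_I meromorphic_on_isolated_singularity meromorphic_on_meromorphic_at meromorphic_on_subset subset_UNIV)
  have "eventually (\<lambda>w. remove_sings h w = 0) (at z0)"
    using eventually_remove_sings_eq_at[OF iso] eq by eventually_elim (simp add: h_def)
  hence "frequently (\<lambda>w. remove_sings h w = 0) (at z0)" by (simp add: eventually_frequently)
  from frequently_eq_meromorphic_imp_constant[OF this remove_sings_nicely_meromorphic[OF mh]]
  have r0: "remove_sings h w = 0" for w by auto
  have ev: "eventually (\<lambda>w. f w = g w) (at z)"
    by (rule eventually_mono[OF eventually_remove_sings_eq_at[OF iso]]) (use r0 in \<open>simp add: h_def\<close>)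
  show "f z = g z"
  proof (cases "is_pole f z")
    case True
    hence "is_pole g z" using is_pole_cong[OF ev refl] by simp
    \<comment> \<open>A function has no finite limit at a pole, which leaves only the other
      alternative of \<open>nicely_meromorphic_on\<close>, the value \<open>0\<close>.\<close>
    moreover have "\<not> f \<midarrow>z\<rightarrow> f z" "\<not> g \<midarrow>z\<rightarrow> g z"
      using True \<open>is_pole g z\<close> is_pole_def not_tendsto_and_filterlim_at_infinity[of "at z"] by auto
    ultimately have "f z = 0" "g z = 0" using f g unfolding nicely_meromorphic_on_def by blast+
    thus ?thesis by simp
  next
    case False
    hence "\<not> is_pole g z" using is_pole_cong[OF ev refl] by simp
    hence "f \<midarrow>z\<rightarrow> f z" "g \<midarrow>z\<rightarrow> g z" using False f g by (auto simp: nicely_meromorphic_on_def)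
    moreover from this(1) have "g \<midarrow>z\<rightarrow> f z" using ev by (rule Lim_transform_eventually)
    ultimately show ?thesis by (intro tendsto_unique[of "at z" g]) auto
  qed
qed

lemma zeta_eq_riemann_zeta: "zeta = riemann_zeta"
  unfolding zeta_def
proof (rule the_equality)
  show "riemann_zeta nicely_meromorphic_on UNIV \<and> (\<forall>s. Re s > 1 \<longrightarrow> (\<lambda>n. 1 / of_nat (Suc n) powr s) sums riemann_zeta s)"
    using riemann_zeta_nicely_meromorphic zeta_series_sums_riemann_zeta by blast
next
  fix f assume f: "f nicely_meromorphic_on UNIV \<and> (\<forall>s. Re s > 1 \<longrightarrow> (\<lambda>n. 1 / of_nat (Suc n) powr s) sums f s)"
  have "eventually (\<lambda>s. s \<in> {s. Re s > 1}) (nhds (2::complex))"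
    by (rule eventually_nhds_in_open) (auto simp: open_halfspace_Re_gt)
  hence "eventually (\<lambda>s. Re s > 1) (at (2::complex))"
    by (auto simp: eventually_at_filter elim: eventually_mono)
  hence "eventually (\<lambda>s. f s = riemann_zeta s) (at 2)"
    by eventually_elim (use f zeta_series_sums_riemann_zeta sums_unique2 in blast)
  thus "f = riemann_zeta"
    using f riemann_zeta_nicely_meromorphic by (intro nicely_meromorphic_eqI) auto
qed

text \<open>Off a discrete set the product defining \<open>xi\<close> is \<open>riemann_xi\<close>;
  the values filled in are limits, and \<open>riemann_xi\<close> is continuous.\<close>

lemma xi_eq_riemann_xi: "xi = riemann_xi"
proof
  fix z :: complex
  let ?F = "\<lambda>z. 1 / 2 * z * (1 - z) * of_real pi powr (- z / 2) * Gamma (z / 2) * zeta z"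
  \<comment> \<open>The zeros of \<open>rGamma (w / 2)\<close> are \<open>0\<close> and the trivial
    zeros, where the Gamma factor has its poles. They are isolated because the value at
    \<open>2\<close> is nonzero.\<close>
  have "eventually (\<lambda>w. rGamma (w / 2) \<noteq> 0 \<and> w \<in> UNIV) (at z)"
    by (rule non_zero_neighbour_alt[of _ _ _ 2]) (auto intro!: holomorphic_intros)
  moreover have "eventually (\<lambda>w. w \<noteq> 1) (at z)"
    by (simp add: eventually_neq_at_within)
  ultimately have "eventually (\<lambda>w. riemann_xi w = ?F w) (at z)"
  proof eventually_elim
    case (elim w)
    have 1: "complex_of_real pi powr (- w / 2) * of_real pi powr (w / 2) = 1"
      by (simp add: powr_minus minus_divide_left [symmetric])
    have 2: "w / 2 * Gamma (w / 2) * rGamma (w / 2 + 1) = 1"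
      using rGamma_plus1[of "w / 2"] elim by (simp add: rGamma_inverse_Gamma field_simps)
    have "?F w = riemann_xi w * ((1 - w) / (1 - w)) * (complex_of_real pi powr (- w / 2) * of_real pi powr (w / 2)) *
          (w / 2 * Gamma (w / 2) * rGamma (w / 2 + 1))"
      unfolding zeta_eq_riemann_zeta riemann_zeta_def by (simp add: mult_ac)
    also have "\<dots> = riemann_xi w" unfolding 1 2 using elim by simp
    finally show ?case by simp
  qed
  hence "?F \<midarrow>z\<rightarrow> riemann_xi z"
    by (rule Lim_transform_eventually [OF isContD [OF analytic_at_imp_isCont [OF analytic_riemann_xi]]])
  thus "xi z = riemann_xi z" unfolding xi_def by (rule remove_sings_eqI)
qed

section \<open>Zeros of zeta and of xi, with their orders\<close>

lemma riemann_xi_neg_even_nonzero: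
  assumes "n \<ge> 1"
  shows "riemann_xi (- 2 * of_nat n) \<noteq> 0"
proof
  assume "riemann_xi (- 2 * of_nat n) = 0"
  \<comment> \<open>The symmetry moves \<open>- 2 n\<close> to \<open>1 + 2 n\<close>, where the
    Dirichlet series converges and is at least \<open>1\<close>.\<close>
  hence "riemann_xi (of_real (1 + 2 * real n)) = 0"
    using riemann_xi_symmetric[of "- 2 * of_nat n"] by simp
  hence "riemann_zeta (of_real (1 + 2 * real n)) = 0"
    by (simp only: riemann_zeta_def) simp
  thus False using norm_riemann_zeta_real_ge_1[of "1 + 2 * real n"] assms by simp
qed

text \<open>The shift by one leaves out \<open>s = 0\<close>: the equation
  \<open>s / 2 + 1 = - k\<close> means \<open>s = - 2 (k + 1)\<close>.\<close>

lemma rGamma_half_plus1_eq_0_iff: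
  "rGamma (s / 2 + 1 :: complex) = 0 \<longleftrightarrow> s \<in> zeta_trivial_zeros"
proof
  assume "rGamma (s / 2 + 1) = 0"
  then obtain k where k: "s / 2 + 1 = - of_nat k"
    by (auto simp: rGamma_eq_zero_iff elim!: nonpos_Ints_cases')
  hence "s = - 2 * of_nat (Suc k)" by (simp add: field_simps eq_neg_iff_add_eq_0)
  thus "s \<in> zeta_trivial_zeros" unfolding zeta_trivial_zeros_def by (intro CollectI exI[of _ "Suc k"]) simp
next
  assume "s \<in> zeta_trivial_zeros"
  then obtain n where n: "s = - 2 * of_nat n" "n \<ge> 1" by (auto simp: zeta_trivial_zeros_def)
  hence "s / 2 + 1 = - of_nat (n - 1)" by (simp add: of_nat_diff)
  thus "rGamma (s / 2 + 1) = 0" by (simp add: rGamma_eq_zero_iff)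
qed

text \<open>The factors of \<open>riemann_zeta\<close> separate the two kinds of zeros. Neither
  factor vanishes at \<open>1\<close>, where the value \<open>0\<close> is mere convention. By the
  second claim the union is disjoint, so the zeros of \<open>xi\<close> are exactly the non-trivial
  ones.\<close>

lemma zeta_zeros_eq: "zeta_zeros = {s. xi s = 0} \<union> zeta_trivial_zeros"
  and xi_trivial_zero_nonzero: "s \<in> zeta_trivial_zeros \<Longrightarrow> xi s \<noteq> 0"
proof -
  show "s \<in> zeta_trivial_zeros \<Longrightarrow> xi s \<noteq> 0"
    using riemann_xi_neg_even_nonzero by (auto simp: xi_eq_riemann_xi zeta_trivial_zeros_def)
  have "(1::complex) \<notin> zeta_trivial_zeros"
    by (auto simp: zeta_trivial_zeros_def complex_eq_iff)
  thus "zeta_zeros = {s. xi s = 0} \<union> zeta_trivial_zeros"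
    unfolding zeta_zeros_def zeta_eq_riemann_zeta is_pole_riemann_zeta_iff xi_eq_riemann_xi
    by (auto simp: riemann_zeta_def rGamma_half_plus1_eq_0_iff riemann_xi_1)
qed

text \<open>The reciprocal Gamma function has only simple zeros, and the remaining factor
  \<open>g\<close> does not vanish at \<open>s\<close>; so the derivative of the product is
  nonzero.\<close>

lemma zorder_zeta_trivial_zero:
  assumes "s \<in> zeta_trivial_zeros"
  shows "zorder zeta s = 1"
proof -
  obtain n where n: "s = - 2 * of_nat n" "n \<ge> 1" using assms by (auto simp: zeta_trivial_zeros_def)
  have s1: "s \<noteq> 1" using n by (auto simp: complex_eq_iff)
  define g where "g w = riemann_xi w * of_real pi powr (w / 2) / (1 - w)" for w
  have zeta: "zeta = (\<lambda>w. g w * rGamma (w / 2 + 1))"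
    by (simp add: zeta_eq_riemann_zeta riemann_zeta_def fun_eq_iff g_def)
  have g: "g holomorphic_on - {1}" unfolding g_def [abs_def]
    by (intro holomorphic_intros holomorphic_riemann_xi) auto
  have gs: "g s \<noteq> 0" using riemann_xi_neg_even_nonzero[OF n(2), folded n(1)] s1[symmetric] by (simp add: g_def)
  have arg: "s / 2 + 1 = - of_nat (n - 1)" using n by (simp add: of_nat_diff)
  have r0: "rGamma (s / 2 + 1) = 0" using assms rGamma_half_plus1_eq_0_iff by blast
  have "(rGamma has_field_derivative (-1) ^ (n - 1) * fact (n - 1)) (at (s / 2 + 1))"
    unfolding arg by (rule has_field_derivative_rGamma_nonpos_int)
  hence dr: "((\<lambda>w. rGamma (w / 2 + 1)) has_field_derivative (-1) ^ (n - 1) * fact (n - 1) * (1 / 2)) (at s)"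
    by (rule DERIV_chain2[where f = rGamma and g = "\<lambda>w. w / 2 + 1"]) (auto intro!: derivative_eq_intros)
  have "(zeta has_field_derivative deriv g s * rGamma (s / 2 + 1) + (-1) ^ (n - 1) * fact (n - 1) * (1 / 2) * g s) (at s)"
    unfolding zeta using s1 by (intro DERIV_mult dr holomorphic_derivI[OF g]) auto
  hence "deriv zeta s \<noteq> 0" using gs r0 by (simp add: DERIV_imp_deriv)
  show ?thesis
  proof (rule zorder_zero_eqI[where S = "- {1}"])
    show "zeta holomorphic_on - {1}" unfolding zeta by (intro holomorphic_intros g) auto
    show "(deriv ^^ nat 1) zeta s \<noteq> 0" using \<open>deriv zeta s \<noteq> 0\<close> by simp
    show "(deriv ^^ i) zeta s = 0" if "i < nat 1" for i
      using that r0 by (simp add: zeta)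
  qed (use s1 in auto)
qed

text \<open>If \<open>xi\<close> were constantly \<open>- 1 / 2\<close>, then \<open>zeta 8\<close> would be \<open>pi ^ 4 / 336 < 1\<close>.\<close>

lemma xi_not_constant: "\<not> (\<forall>s. xi s = c)"
proof
  assume *: "\<forall>s. xi s = c"
  hence "c = - 1 / 2" by (metis xi_eq_riemann_xi riemann_xi_0)
  hence xi8: "riemann_xi 8 = - 1 / 2" using * by (metis xi_eq_riemann_xi)
  have "Gamma (5 :: complex) = 24"
    using Gamma_fact[of 4, where 'a = complex] by (simp add: fact_numeral)
  hence "rGamma (5 :: complex) = 1 / 24"
    by (simp only: rGamma_inverse_Gamma inverse_eq_divide)
  moreover have "8 / 2 + 1 = (5 :: complex)" by simp
  ultimately have "rGamma (8 / 2 + 1 :: complex) = 1 / 24" by (simp only:)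
  moreover have "complex_of_real pi powr (8 / 2) = of_real (pi ^ 4)"
    using powr_of_real[of pi 4] by simp
  ultimately have "riemann_zeta 8 = of_real (pi ^ 4 / 336)"
    unfolding riemann_zeta_def xi8 by (simp add: mult.commute)
  hence "norm (riemann_zeta 8) = pi ^ 4 / 336" by (simp only: norm_of_real) simp
  \<comment> \<open>Among the even arguments, \<open>8\<close> is the first for which the crude
    bound \<open>pi < 4\<close> suffices: \<open>4 ^ 4 = 256 < 336\<close>.\<close>
  moreover have "pi ^ 4 < 4 ^ 4" using pi_less_4 by (intro power_strict_mono) auto
  ultimately show False using norm_riemann_zeta_real_ge_1[of 8] by simp
qed

text \<open>The cofactor \<open>g\<close> is singular only at \<open>1\<close> and vanishes only at
  trivial zeros. A zero of \<open>xi\<close> is neither, so \<open>g\<close> contributes order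
  \<open>0\<close>.\<close>

lemma zorder_zeta_eq_zorder_xi:
  assumes "xi s = 0"
  shows "zorder zeta s = zorder xi s"
proof -
  define g :: "complex \<Rightarrow> complex" where "g w = of_real pi powr (w / 2) * rGamma (w / 2 + 1) / (1 - w)" for w
  have s1: "s \<noteq> 1" using assms by (auto simp: xi_eq_riemann_xi riemann_xi_1)
  have nt: "s \<notin> zeta_trivial_zeros" using assms xi_trivial_zero_nonzero by blast
  have zeta: "zeta = (\<lambda>w. xi w * g w)"
    by (simp add: zeta_eq_riemann_zeta xi_eq_riemann_xi riemann_zeta_def fun_eq_iff g_def)
  have "g holomorphic_on - {1}" unfolding g_def [abs_def]
    by (intro holomorphic_intros) auto
  hence g: "g analytic_on {s}"
    using s1 by (metis ComplI analytic_at open_Compl closed_singleton singletonD finite.emptyI finite_imp_closed finite.insertI)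
  have gs: "g s \<noteq> 0" using nt s1 by (simp add: g_def rGamma_half_plus1_eq_0_iff)
  obtain c where c: "xi c \<noteq> 0" using xi_eq_riemann_xi riemann_xi_0 by (metis divide_eq_0_iff neg_equal_0_iff_equal one_neq_zero zero_neq_numeral)
  have "eventually (\<lambda>w. xi w \<noteq> 0 \<and> w \<in> UNIV) (at s)"
    by (rule non_zero_neighbour_alt[of _ _ _ c]) (use c in \<open>auto simp: xi_eq_riemann_xi holomorphic_riemann_xi\<close>)
  moreover have "eventually (\<lambda>w. g w \<noteq> 0) (at s)"
    using g gs by (metis analytic_at_imp_isCont isContD tendsto_imp_eventually_ne)
  ultimately have "eventually (\<lambda>w. xi w * g w \<noteq> 0) (at s)" by eventually_elim auto
  hence "zorder zeta s = zorder xi s + zorder g s"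
    unfolding zeta by (intro zorder_times_analytic g) (auto simp: xi_eq_riemann_xi analytic_riemann_xi)
  also have "zorder g s = 0" by (rule zorder_eq_0I[OF g gs])
  finally show ?thesis by simp
qed

section \<open>Attracting fixed points of meromorphic functions\<close>

text \<open>
  After transport to the unit disk by a Riemann map, Brouwer's theorem gives a fixed point, and the
  Schwarz lemma bounds the multiplier; equality would make the map a rotation, hence onto.
\<close>

lemma compact_self_map_fixed_point:
  assumes S: "open S" "S homeomorphic (ball 0 1 :: complex set)" "S \<noteq> UNIV"
    and n: "n holomorphic_on S" and K: "compact K" "K \<subseteq> S" "n ` S \<subseteq> K"
  obtains \<alpha> where "\<alpha> \<in> S" "n \<alpha> = \<alpha>" "norm (deriv n \<alpha>) < 1"
proof -
  have "simply_connected S"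
    using homeomorphic_simply_connected_eq[OF S(2)] by (simp add: convex_imp_simply_connected)
  moreover have "S \<noteq> {}"
    using S(2) by auto
  ultimately obtain f g where f: "f holomorphic_on S" and g: "g holomorphic_on ball 0 1"
    and fg': "\<forall>z\<in>S. f z \<in> ball 0 1 \<and> g (f z) = z"
    and gf': "\<forall>z\<in>ball 0 1. g z \<in> S \<and> f (g z) = z"
    using simply_connected_eq_biholomorphic_to_disc[OF S(1)] S(3) by blast
  have fg: "\<And>z. z \<in> S \<Longrightarrow> f z \<in> ball 0 1" "\<And>z. z \<in> S \<Longrightarrow> g (f z) = z"
    using fg' by blast+
  have gf: "\<And>z. z \<in> ball 0 1 \<Longrightarrow> g z \<in> S" "\<And>z. z \<in> ball 0 1 \<Longrightarrow> f (g z) = z"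
    using gf' by blast+
  have "compact (f ` K)"
    using K f by (intro compact_continuous_image holomorphic_on_imp_continuous_on holomorphic_on_subset[OF f])
  moreover have "K \<noteq> {}" using K \<open>S \<noteq> {}\<close> by auto
  ultimately obtain y where y: "y \<in> f ` K" "\<And>x. x \<in> f ` K \<Longrightarrow> dist 0 x \<le> dist 0 y"
    using distance_attains_sup[of "f ` K" 0] by auto
  define r where "r = max (norm y) (1/2)"
  have r: "0 < r" "r < 1" using y(1) fg(1) K(2) by (auto simp: r_def)
  have r_bound: "norm (f (n w)) \<le> r" if "w \<in> S" for w
    using y(2)[of "f (n w)"] K(3) that by (force simp: r_def)
  define F where "F = f \<circ> n \<circ> g"
  have gimg: "g ` ball 0 1 \<subseteq> S" using gf by auto
  have nimg: "n ` S \<subseteq> S" using K by auto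
  have "F holomorphic_on ball 0 1"
    unfolding F_def
    using g n f gimg nimg by (intro holomorphic_on_compose_gen[where t = S]) auto
  hence contF: "continuous_on (cball 0 r) F"
    using r by (intro holomorphic_on_imp_continuous_on) (auto elim: holomorphic_on_subset)
  have Fr: "norm (F z) \<le> r" if "z \<in> ball 0 1" for z
    using r_bound gf(1)[OF that] by (simp add: F_def)
  have "F \<in> cball 0 r \<rightarrow> cball 0 r"
    using Fr r by auto
  then obtain a where a: "a \<in> cball 0 r" "F a = a"
    using brouwer_ball[OF r(1) contF] by blast
  hence a1: "a \<in> ball 0 1" using r by auto
  define \<alpha> where "\<alpha> = g a"
  have \<alpha>: "\<alpha> \<in> S" using gf a1 by (simp add: \<alpha>_def)
  have "n \<alpha> = g (f (n \<alpha>))" using fg(2)[of "n \<alpha>"] nimg \<alpha> by auto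
  also have "f (n \<alpha>) = a" using a by (simp add: F_def \<alpha>_def)
  finally have fixpt: "n \<alpha> = \<alpha>" by (simp add: \<alpha>_def)
  \<comment> \<open>An automorphism of the disk moves the fixed point to the origin, where the
    Schwarz lemma applies.\<close>
  obtain p q where pq: "p a = 0" "p holomorphic_on ball 0 1" "p ` ball 0 1 \<subseteq> ball 0 1"
     "q holomorphic_on ball 0 1" "q ` ball 0 1 \<subseteq> ball 0 1"
     "\<And>z. z \<in> ball 0 1 \<Longrightarrow> p (q z) = z" "\<And>z. z \<in> ball 0 1 \<Longrightarrow> q (p z) = z"
    using ball_biholomorphism_exists[OF a1] by metis
  have pb: "p z \<in> ball 0 1" and qb: "q z \<in> ball 0 1" if "z \<in> ball 0 1" for z
    using pq(3,5) that by blast+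
  define \<psi> where "\<psi> = p \<circ> f"
  define \<phi> where "\<phi> = g \<circ> q"
  have \<psi>: "\<psi> holomorphic_on S" "\<And>z. z \<in> S \<Longrightarrow> \<psi> z \<in> ball 0 1" "\<psi> \<alpha> = 0"
  proof -
    show "\<psi> holomorphic_on S"
      unfolding \<psi>_def by (rule holomorphic_on_compose_gen[OF f pq(2)]) (use fg(1) in blast)
    show "\<psi> z \<in> ball 0 1" if "z \<in> S" for z
      using pb[OF fg(1)[OF that]] by (simp add: \<psi>_def)
    show "\<psi> \<alpha> = 0" using gf(2)[OF a1] pq(1) by (simp add: \<psi>_def \<alpha>_def)
  qed
  have \<phi>: "\<phi> holomorphic_on ball 0 1" "\<And>z. z \<in> ball 0 1 \<Longrightarrow> \<phi> z \<in> S"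
  proof -
    show "\<phi> holomorphic_on ball 0 1"
      unfolding \<phi>_def by (rule holomorphic_on_compose_gen[OF pq(4) g pq(5)])
    show "\<phi> z \<in> S" if "z \<in> ball 0 1" for z
      using gf(1)[OF qb[OF that]] by (simp add: \<phi>_def)
  qed
  have q0: "q 0 = a" using pq(7)[OF a1] pq(1) by simp
  hence \<phi>0: "\<phi> 0 = \<alpha>" by (simp add: \<phi>_def \<alpha>_def)
  have \<psi>\<phi>: "\<psi> (\<phi> z) = z" if "z \<in> ball 0 1" for z
    using pq(6)[OF that] gf(2)[OF qb[OF that]] by (simp add: \<psi>_def \<phi>_def)
  have d\<phi>: "(\<phi> has_field_derivative deriv \<phi> 0) (at 0)"
    by (rule holomorphic_derivI[OF \<phi>(1)]) auto
  have d\<psi>: "(\<psi> has_field_derivative deriv \<psi> \<alpha>) (at \<alpha>)"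
    by (rule holomorphic_derivI[OF \<psi>(1) S(1) \<alpha>])
  have dn: "(n has_field_derivative deriv n \<alpha>) (at \<alpha>)"
    by (rule holomorphic_derivI[OF n S(1) \<alpha>])
  \<comment> \<open>Since \<open>\<psi>\<close> inverts \<open>\<phi>\<close>, conjugating
    \<open>n\<close> by them leaves the multiplier unchanged.\<close>
  have one: "deriv \<psi> \<alpha> * deriv \<phi> 0 = 1"
  proof -
    have "((\<lambda>z. \<psi> (\<phi> z)) has_field_derivative deriv \<psi> \<alpha> * deriv \<phi> 0) (at 0)"
      using d\<psi> by (intro DERIV_chain2[where f = \<psi> and g = \<phi>] d\<phi>) (simp add: \<phi>0)
    moreover have "((\<lambda>z. \<psi> (\<phi> z)) has_field_derivative 1) (at 0)"
      by (rule has_field_derivative_transform_within[OF DERIV_ident, of 1]) (auto simp: \<psi>\<phi>)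
    ultimately show ?thesis by (rule DERIV_unique)
  qed
  define G where "G = (\<lambda>z. \<psi> (n (\<phi> z)))"
  have dG: "(G has_field_derivative deriv \<psi> \<alpha> * (deriv n \<alpha> * deriv \<phi> 0)) (at 0)"
    unfolding G_def
  proof (rule DERIV_chain2[where f = \<psi> and g = "\<lambda>z. n (\<phi> z)"])
    show "((\<lambda>z. n (\<phi> z)) has_field_derivative deriv n \<alpha> * deriv \<phi> 0) (at 0)"
      using dn by (intro DERIV_chain2[where f = n and g = \<phi>] d\<phi>) (simp add: \<phi>0)
    show "(\<psi> has_field_derivative deriv \<psi> \<alpha>) (at (n (\<phi> 0)))"
      using d\<psi> by (simp add: \<phi>0 fixpt)
  qed
  hence derivG: "deriv G 0 = deriv n \<alpha>"
    using one by (simp add: DERIV_imp_deriv mult_ac)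
  have holG: "G holomorphic_on ball 0 1"
  proof -
    have "(\<psi> \<circ> (n \<circ> \<phi>)) holomorphic_on ball 0 1"
      using \<phi> \<psi>(1) n nimg by (intro holomorphic_on_compose_gen[where t = S]) auto
    thus ?thesis by (simp add: G_def o_def)
  qed
  have G0: "G 0 = 0" by (simp add: G_def \<phi>0 fixpt \<psi>(3))
  have G1: "norm (G z) < 1" if "norm z < 1" for z
    using \<psi>(2)[of "n (\<phi> z)"] \<phi>(2)[of z] nimg that by (auto simp: G_def)
  have "norm (deriv G 0) \<le> 1"
    using Schwarz_Lemma(2)[OF holG G0 G1, of 0] by simp
  moreover have "norm (deriv G 0) \<noteq> 1"
  proof
    assume "norm (deriv G 0) = 1"
    then obtain \<beta> where \<beta>: "\<And>z. norm z < 1 \<Longrightarrow> G z = \<beta> * z" "norm \<beta> = 1"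
      using Schwarz_Lemma(3)[OF holG G0 G1, of 0] by auto
    \<comment> \<open>A point of the disk of modulus greater than \<open>r\<close>: \<open>F\<close>
      does not attain it, but it would if \<open>G\<close> were a rotation.\<close>
    define w where "w = complex_of_real ((1 + r) / 2)"
    have w: "norm w < 1" "norm w > r" using r by (auto simp: w_def simp del: of_real_divide of_real_add)
    have pw: "norm (p w) < 1" using pb[of w] w by simp
    define z where "z = p w / \<beta>"
    have "norm z < 1" using pw \<beta>(2) by (simp add: z_def norm_divide)
    have "\<beta> \<noteq> 0" using \<beta>(2) by auto
    hence "p w = G z" using \<beta>(1)[OF \<open>norm z < 1\<close>] by (simp add: z_def)
    also have "\<dots> = p (f (n (\<phi> z)))" by (simp add: G_def \<psi>_def)
    finally have "q (p w) = q (p (f (n (\<phi> z))))" by simp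
    moreover have nS: "n (\<phi> z) \<in> S" using \<phi>(2)[of z] nimg \<open>norm z < 1\<close> by auto
    ultimately have "w = f (n (\<phi> z))"
      using pq(7)[of w] pq(7)[of "f (n (\<phi> z))"] fg(1)[OF nS] w by simp
    hence "norm w \<le> r" using r_bound[of "\<phi> z"] \<phi>(2)[of z] \<open>norm z < 1\<close> by auto
    with w show False by simp
  qed
  ultimately show ?thesis using that[OF \<alpha> fixpt] derivG by simp
qed

section \<open>Meromorphic maps into the sphere and absorbing disks\<close>

lemma remove_sings_analytic_at_nonpole:
  assumes f: "f meromorphic_on UNIV" and z: "\<not> is_pole f z"
  shows "remove_sings f analytic_on {z}"
proof (rule nicely_meromorphic_on_imp_analytic_at)
  show "remove_sings f nicely_meromorphic_on UNIV" by (rule remove_sings_nicely_meromorphic[OF f])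
  have "isolated_singularity_at f z"
    using f by (meson UNIV_I meromorphic_on_isolated_singularity meromorphic_on_meromorphic_at)
  thus "\<not> is_pole (remove_sings f) z" using z by simp
qed auto

lemma multiplier_sphere_map:
  assumes f: "f meromorphic_on UNIV" and z: "\<not> is_pole f z"
  shows "multiplier (sphere_map f) z = deriv (remove_sings f) z"
proof -
  have "isolated_singularity_at f z"
    using f by (meson UNIV_I meromorphic_on_isolated_singularity meromorphic_on_meromorphic_at)
  hence "eventually (\<lambda>w. \<not> is_pole f w) (at z)" by (rule eventually_not_pole)
  hence "eventually (\<lambda>w. \<not> is_pole f w) (nhds z)" using z by (simp add: eventually_nhds_conv_at)
  hence "eventually (\<lambda>w. the (sphere_map f w) = remove_sings f w) (nhds z)"
    by eventually_elim (simp add: sphere_map_def)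
  thus ?thesis unfolding multiplier_def by (intro deriv_cong_ev refl)
qed

lemma topspace_riemann_sphere: "topspace riemann_sphere = UNIV"
  unfolding riemann_sphere_def by (auto simp: UNIV_option_conv)

text \<open>A small ball of radius \<open>r\<close> is mapped into the concentric closed ball of
  radius \<open>k * r\<close> with \<open>k < 1\<close>. That ball is compact, hence closed in the
  sphere too, so the closure cannot reach infinity.\<close>

lemma attracting_imp_absorbing_disk:
  assumes f: "f meromorphic_on UNIV" and at: "attracting (sphere_map f) \<alpha>"
  shows "\<exists>D. topological_disk D \<and> riemann_sphere closure_of (sphere_map f ` D) \<subseteq> Some ` D"
proof -
  define n where "n = remove_sings f"
  have fp: "sphere_map f \<alpha> = Some \<alpha>" using at by (simp add: attracting_def fixed_point_def)
  hence np: "\<not> is_pole f \<alpha>" and n\<alpha>: "n \<alpha> = \<alpha>" by (auto simp: sphere_map_def n_def split: if_splits)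
  have lt: "norm (deriv n \<alpha>) < 1"
    using at multiplier_sphere_map[OF f np] by (simp add: attracting_def n_def)
  have "isolated_singularity_at f \<alpha>"
    using f by (meson UNIV_I meromorphic_on_isolated_singularity meromorphic_on_meromorphic_at)
  hence ev1: "eventually (\<lambda>w. \<not> is_pole f w) (at \<alpha>)" by (rule eventually_not_pole)
  \<comment> \<open>Halfway between the modulus of the multiplier and \<open>1\<close>: the
    difference quotients eventually fall below \<open>k\<close>, and \<open>k < 1\<close> leaves
    room inside the disk.\<close>
  define k where "k = (1 + norm (deriv n \<alpha>)) / 2"
  have k: "0 < k" "norm (deriv n \<alpha>) < k" "k < 1" using lt by (auto simp: k_def intro: add_pos_nonneg)
  have "n analytic_on {\<alpha>}" unfolding n_def by (rule remove_sings_analytic_at_nonpole[OF f np])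
  hence "(n has_field_derivative deriv n \<alpha>) (at \<alpha>)"
    by (meson analytic_on_imp_differentiable_at field_differentiable_derivI singletonI)
  hence "((\<lambda>w. (n w - n \<alpha>) / (w - \<alpha>)) \<longlongrightarrow> deriv n \<alpha>) (at \<alpha>)"
    by (simp add: has_field_derivative_iff)
  hence "((\<lambda>w. norm ((n w - n \<alpha>) / (w - \<alpha>))) \<longlongrightarrow> norm (deriv n \<alpha>)) (at \<alpha>)"
    by (rule tendsto_norm)
  hence "eventually (\<lambda>w. norm ((n w - n \<alpha>) / (w - \<alpha>)) < k) (at \<alpha>)"
    using k by (intro order_tendstoD)
  hence "eventually (\<lambda>w. \<not> is_pole f w \<and> norm (n w - \<alpha>) \<le> k * norm (w - \<alpha>)) (at \<alpha>)"
    using ev1 eventually_neq_at_within[of \<alpha> \<alpha> UNIV]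
  proof eventually_elim
    case (elim w)
    thus ?case by (simp add: n\<alpha> norm_divide divide_simps)
  qed
  hence "eventually (\<lambda>w. \<not> is_pole f w \<and> norm (n w - \<alpha>) \<le> k * norm (w - \<alpha>)) (nhds \<alpha>)"
    using np n\<alpha> by (simp add: eventually_nhds_conv_at)
  then obtain r where r: "r > 0" "\<And>w. dist w \<alpha> < r \<Longrightarrow> \<not> is_pole f w \<and> norm (n w - \<alpha>) \<le> k * norm (w - \<alpha>)"
    by (auto simp: eventually_nhds_metric)
  have sub: "sphere_map f ` ball \<alpha> r \<subseteq> Some ` cball \<alpha> (k * r)"
  proof safe
    fix w assume w: "w \<in> ball \<alpha> r"
    hence w': "\<not> is_pole f w" "norm (n w - \<alpha>) \<le> k * norm (w - \<alpha>)" using r(2)[of w] by (auto simp: dist_commute)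
    have "k * norm (w - \<alpha>) \<le> k * r"
      using w k by (intro mult_left_mono) (auto simp: dist_norm norm_minus_commute)
    hence "n w \<in> cball \<alpha> (k * r)" using w' by (simp add: dist_norm norm_minus_commute)
    thus "sphere_map f w \<in> Some ` cball \<alpha> (k * r)" using w' by (simp add: sphere_map_def n_def)
  qed
  have "closedin riemann_sphere (Some ` cball \<alpha> (k * r))"
    unfolding riemann_sphere_def by simp
  with sub have "riemann_sphere closure_of (sphere_map f ` ball \<alpha> r) \<subseteq> Some ` cball \<alpha> (k * r)"
    by (rule closure_of_minimal)
  also have "\<dots> \<subseteq> Some ` ball \<alpha> r"
  proof (rule image_mono)
    have "k * r < 1 * r" using k r(1) by (intro mult_strict_right_mono) auto
    thus "cball \<alpha> (k * r) \<subseteq> ball \<alpha> r" by auto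
  qed
  finally have "riemann_sphere closure_of (sphere_map f ` ball \<alpha> r) \<subseteq> Some ` ball \<alpha> r" .
  moreover have "topological_disk (ball \<alpha> r)"
    unfolding topological_disk_def using r(1) by (auto intro: homeomorphic_balls)
  ultimately show ?thesis by blast
qed

text \<open>The closure misses \<open>None\<close>, so by the topology of the one-point
  compactification it is a compact subset \<open>K\<close> of the plane. The pole \<open>p\<close>
  is mapped to \<open>None\<close> and thus lies outside \<open>D\<close>; this gives
  \<open>D \<noteq> UNIV\<close>, without which there is no Riemann map.\<close>

lemma absorbing_disk_imp_attracting:
  assumes f: "f meromorphic_on UNIV" and pole: "is_pole f p"
    and D: "topological_disk D" "riemann_sphere closure_of (sphere_map f ` D) \<subseteq> Some ` D"
  shows "\<exists>\<alpha>. attracting (sphere_map f) \<alpha>"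
proof -
  define n where "n = remove_sings f"
  define C where "C = riemann_sphere closure_of (sphere_map f ` D)"
  have DC: "sphere_map f ` D \<subseteq> C"
    unfolding C_def by (rule closure_of_subset) (simp add: topspace_riemann_sphere)
  have "closedin riemann_sphere C" by (simp add: C_def)
  moreover have "None \<notin> C" using D(2) by (auto simp: C_def)
  ultimately obtain K where K: "compact K" "C = Some ` K"
    unfolding riemann_sphere_def closedin_Alexandroff_compactification by auto
  have KD: "K \<subseteq> D" using D(2) unfolding C_def [symmetric] K(2) by auto
  have np: "\<not> is_pole f w" and nK: "n w \<in> K" if "w \<in> D" for w
    using DC that K(2) by (auto simp: sphere_map_def n_def split: if_splits)
  have "n holomorphic_on D"
    unfolding n_def using remove_sings_analytic_at_nonpole[OF f np] analytic_imp_holomorphic analytic_on_analytic_at by blast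
  moreover have "D \<noteq> UNIV" using np[of p] pole by auto
  ultimately obtain \<alpha> where \<alpha>: "\<alpha> \<in> D" "n \<alpha> = \<alpha>" "norm (deriv n \<alpha>) < 1"
    using compact_self_map_fixed_point[of D n K] D(1) K(1) KD nK unfolding topological_disk_def by blast
  have "attracting (sphere_map f) \<alpha>"
    using \<alpha> np[of \<alpha>] multiplier_sphere_map[OF f np[of \<alpha>]]
    by (simp add: attracting_def fixed_point_def sphere_map_def n_def)
  thus ?thesis by blast
qed

section \<open>Newton's method damped by the factor \<open>1 / z\<close>\<close>

definition modified_newton :: "(complex \<Rightarrow> complex) \<Rightarrow> complex \<Rightarrow> complex" where
  "modified_newton h z = z - h z / (z * deriv h z)"

context
  fixes h :: "complex \<Rightarrow> complex"
  assumes hol: "h holomorphic_on UNIV" and h0: "h 0 \<noteq> 0" and nonconst: "\<And>c. \<exists>z. h z \<noteq> c"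
begin

lemma eventually_deriv_nonzero: "eventually (\<lambda>w. w \<noteq> 0 \<and> deriv h w \<noteq> 0) (at z)"
proof -
  have "\<exists>b. deriv h b \<noteq> 0"
  proof (rule ccontr)
    assume "\<not> ?thesis"
    hence "h constant_on UNIV"
      using hol by (intro has_field_derivative_0_imp_constant_on[of UNIV h])
        (metis UNIV_I holomorphic_derivI open_UNIV, auto)
    thus False using nonconst by (auto simp: constant_on_def)
  qed
  then obtain b where "deriv h b \<noteq> 0" by blast
  hence "eventually (\<lambda>w. deriv h w \<noteq> 0 \<and> w \<in> UNIV) (at z)"
    using hol by (intro non_zero_neighbour_alt[of _ _ _ b] holomorphic_deriv) auto
  moreover have "eventually (\<lambda>w. w \<noteq> 0) (at z)" by (simp add: eventually_neq_at_within)
  ultimately show ?thesis by eventually_elim auto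
qed

lemma entire_analytic: "h analytic_on A" "deriv h analytic_on A"
  using hol by (metis analytic_on_open analytic_on_subset open_UNIV subset_UNIV,
      metis analytic_deriv analytic_on_open analytic_on_subset open_UNIV subset_UNIV)

lemma modified_newton_meromorphic: "modified_newton h meromorphic_on UNIV"
  unfolding modified_newton_def [abs_def]
  by (intro meromorphic_intros analytic_on_imp_meromorphic_on entire_analytic)

text \<open>The denominator tends to \<open>0\<close> through nonzero values, its zeros being
  isolated, while the numerator has a nonzero limit. At \<open>z = 0\<close> this is the pole that
  keeps absorbing disks from filling the plane.\<close>

lemma modified_newton_pole:
  assumes "h z \<noteq> 0" "z * deriv h z = 0"
  shows "is_pole (modified_newton h) z"
proof -
  have "((\<lambda>w. w * deriv h w) \<longlongrightarrow> z * deriv h z) (at z)"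
    by (intro tendsto_intros isContD analytic_at_imp_isCont entire_analytic)
  hence "filterlim (\<lambda>w. w * deriv h w) (at 0) (at z)"
    using eventually_deriv_nonzero[of z] assms(2)
    by (intro filterlim_atI) (auto elim: eventually_mono)
  hence "is_pole (\<lambda>w. h w / (w * deriv h w)) z"
    using assms(1) by (intro is_pole_divide analytic_at_imp_isCont entire_analytic)
  hence "filterlim (\<lambda>w. w + - (h w / (w * deriv h w))) at_infinity (at z)"
    by (intro tendsto_add_filterlim_at_infinity[of _ z] tendsto_ident_at)
       (simp add: is_pole_def [symmetric])
  thus ?thesis by (simp add: is_pole_def modified_newton_def [abs_def])
qed

text \<open>In the quotient of \<open>h\<close> by its derivative all but one factor
  \<open>w - \<alpha>\<close> cancel. The singularity at \<open>\<alpha>\<close> is therefore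
  removable, and the coefficient of the remaining factor determines the derivative.\<close>

lemma modified_newton_at_zero:
  assumes "h \<alpha> = 0"
  defines "m \<equiv> zorder h \<alpha>"
  shows "m > 0" "\<not> is_pole (modified_newton h) \<alpha>" "remove_sings (modified_newton h) \<alpha> = \<alpha>"
    "deriv (remove_sings (modified_newton h)) \<alpha> = 1 - 1 / (of_int m * \<alpha>)"
proof -
  have \<alpha>0: "\<alpha> \<noteq> 0" using assms h0 by auto
  define g where "g = zor_poly h \<alpha>"
  have "zorder h \<alpha> > 0 \<and> (\<exists>r>0. cball \<alpha> r \<subseteq> UNIV \<and> zor_poly h \<alpha> holomorphic_on cball \<alpha> r \<and>
     (\<forall>w\<in>cball \<alpha> r. h w = zor_poly h \<alpha> w * (w - \<alpha>) ^ nat (zorder h \<alpha>) \<and> zor_poly h \<alpha> w \<noteq> 0))"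
    using zorder_exist_zero[OF hol open_UNIV connected_UNIV UNIV_I[of \<alpha>]] h0 assms(1) by auto
  then obtain r where m0: "m > 0" and r: "r > 0" "g holomorphic_on cball \<alpha> r"
     "\<And>w. w \<in> cball \<alpha> r \<Longrightarrow> h w = g w * (w - \<alpha>) ^ nat m \<and> g w \<noteq> 0"
    unfolding g_def m_def by blast
  show "m > 0" by fact
  obtain k where k: "nat m = Suc k" using m0 by (metis gr0_conv_Suc zero_less_nat_eq)
  have mk: "of_int m = (of_nat (Suc k) :: complex)" using k m0 by (metis of_int_of_nat_eq int_nat_eq less_imp_le)
  have gb: "g holomorphic_on ball \<alpha> r" using r(2) by (rule holomorphic_on_subset) auto
  \<comment> \<open>Here \<open>k = m - 1\<close> and
    \<open>w * deriv h w = (w - \<alpha>) ^ k * Q w\<close>. The value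
    \<open>Q \<alpha> = m * \<alpha> * g \<alpha>\<close> is nonzero because
    \<open>h 0 \<noteq> 0\<close> excludes \<open>\<alpha> = 0\<close>.\<close>
  define Q where "Q w = w * (of_nat (Suc k) * g w + (w - \<alpha>) * deriv g w)" for w
  define H where "H w = w - (w - \<alpha>) * (g w / Q w)" for w
  have dh: "deriv h w = (w - \<alpha>) ^ k * (of_nat (Suc k) * g w + (w - \<alpha>) * deriv g w)" if w: "w \<in> ball \<alpha> r" for w
  proof -
    have dg: "(g has_field_derivative deriv g w) (at w)"
      by (rule holomorphic_derivI[OF gb _ w]) auto
    have "((\<lambda>w. g w * (w - \<alpha>) ^ Suc k) has_field_derivative
            (w - \<alpha>) ^ k * (of_nat (Suc k) * g w + (w - \<alpha>) * deriv g w)) (at w)"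
      by (rule DERIV_cong[OF DERIV_mult[OF dg DERIV_power[OF DERIV_diff[OF DERIV_ident DERIV_const]]]])
         (simp add: algebra_simps)
    hence "(h has_field_derivative (w - \<alpha>) ^ k * (of_nat (Suc k) * g w + (w - \<alpha>) * deriv g w)) (at w)"
      by (rule has_field_derivative_transform_within_open[of _ _ _ "ball \<alpha> r"]) (use w r k in auto)
    thus ?thesis by (rule DERIV_imp_deriv)
  qed
  have NH: "modified_newton h w = H w" if w: "w \<in> ball \<alpha> r" "w \<noteq> \<alpha>" for w
  proof -
    define T where "T = of_nat (Suc k) * g w + (w - \<alpha>) * deriv g w"
    have "h w / (w * deriv h w) = ((w - \<alpha>) ^ k * ((w - \<alpha>) * g w)) / ((w - \<alpha>) ^ k * (w * T))"
      using r(3)[of w] w k by (simp add: dh[OF w(1), folded T_def] mult_ac)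
    also have "\<dots> = ((w - \<alpha>) * g w) / (w * T)"
      using w(2) by (intro mult_divide_mult_cancel_left) simp
    finally show ?thesis by (simp add: modified_newton_def H_def Q_def T_def)
  qed
  have evNH: "eventually (\<lambda>w. modified_newton h w = H w) (at \<alpha>)"
    using eventually_at_in_open[of "ball \<alpha> r" \<alpha>] r(1)
    by (auto elim!: eventually_mono intro!: NH)
  have g\<alpha>: "g \<alpha> \<noteq> 0" using r by auto
  have Q\<alpha>: "Q \<alpha> = \<alpha> * of_nat (Suc k) * g \<alpha>" by (simp add: Q_def)
  have Q0: "Q \<alpha> \<noteq> 0" using g\<alpha> \<alpha>0 unfolding Q\<alpha> by (simp del: of_nat_Suc)
  have ga: "g analytic_on {\<alpha>}" using gb r(1) by (meson analytic_at centre_in_ball open_ball)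
  have Qa: "Q analytic_on {\<alpha>}" unfolding Q_def [abs_def]
    by (intro analytic_intros ga analytic_deriv)
  have gQ: "(\<lambda>w. g w / Q w) analytic_on {\<alpha>}" by (intro analytic_intros ga Qa) (use Q0 in auto)
  hence dgQ: "((\<lambda>w. g w / Q w) has_field_derivative deriv (\<lambda>w. g w / Q w) \<alpha>) (at \<alpha>)"
    by (meson analytic_on_imp_differentiable_at field_differentiable_derivI singletonI)
  have Ha: "H analytic_on {\<alpha>}" unfolding H_def [abs_def] by (intro analytic_intros gQ)
  have dH: "(H has_field_derivative 1 - g \<alpha> / Q \<alpha>) (at \<alpha>)"
    unfolding H_def [abs_def] by (rule derivative_eq_intros dgQ refl | simp)+
  have lim: "modified_newton h \<midarrow>\<alpha>\<rightarrow> H \<alpha>"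
    using analytic_at_imp_isCont[OF Ha] evNH tendsto_cong isCont_def by blast
  show "\<not> is_pole (modified_newton h) \<alpha>"
    using is_pole_cong[OF evNH refl] analytic_at_imp_no_pole[OF Ha] by simp
  have "remove_sings (modified_newton h) \<alpha> = H \<alpha>" using lim by (rule remove_sings_eqI)
  thus rs: "remove_sings (modified_newton h) \<alpha> = \<alpha>" by (simp add: H_def)
  have "isolated_singularity_at (modified_newton h) \<alpha>"
    using modified_newton_meromorphic by (meson UNIV_I meromorphic_on_isolated_singularity meromorphic_on_meromorphic_at)
  from eventually_remove_sings_eq_at[OF this] evNH
  have "eventually (\<lambda>w. remove_sings (modified_newton h) w = H w) (at \<alpha>)"
    by eventually_elim simp
  hence "eventually (\<lambda>w. remove_sings (modified_newton h) w = H w) (nhds \<alpha>)"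
    using rs by (simp add: eventually_nhds_conv_at H_def)
  hence "deriv (remove_sings (modified_newton h)) \<alpha> = deriv H \<alpha>" by (intro deriv_cong_ev refl)
  also have "\<dots> = 1 - g \<alpha> / Q \<alpha>" using dH by (rule DERIV_imp_deriv)
  also have "\<dots> = 1 - 1 / (of_int m * \<alpha>)" unfolding Q\<alpha> mk using g\<alpha> \<alpha>0 by simp
  finally show "deriv (remove_sings (modified_newton h)) \<alpha> = 1 - 1 / (of_int m * \<alpha>)" .
qed

text \<open>Where \<open>h\<close> does not vanish, either the denominator does and the point is a
  pole, or the correction \<open>h z / (z * deriv h z)\<close> is finite and nonzero.\<close>

lemma fixed_point_modified_newton_iff:
  "fixed_point (sphere_map (modified_newton h)) \<alpha> \<longleftrightarrow> h \<alpha> = 0"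
proof
  assume fp: "fixed_point (sphere_map (modified_newton h)) \<alpha>"
  show "h \<alpha> = 0"
  proof (rule ccontr)
    assume h\<alpha>: "h \<alpha> \<noteq> 0"
    have "\<not> is_pole (modified_newton h) \<alpha>" "remove_sings (modified_newton h) \<alpha> = \<alpha>"
      using fp by (auto simp: fixed_point_def sphere_map_def split: if_splits)
    moreover from this have nz: "\<alpha> * deriv h \<alpha> \<noteq> 0" using modified_newton_pole[OF h\<alpha>] by blast
    hence "modified_newton h analytic_on {\<alpha>}"
      unfolding modified_newton_def [abs_def]
      by (intro analytic_intros entire_analytic) auto
    ultimately have "modified_newton h \<alpha> = \<alpha>" by simp
    thus False using h\<alpha> nz by (simp add: modified_newton_def)
  qed
qed (use modified_newton_at_zero in \<open>simp add: fixed_point_def sphere_map_def\<close>)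

lemma multiplier_modified_newton:
  assumes "h \<alpha> = 0"
  shows "multiplier (sphere_map (modified_newton h)) \<alpha> = 1 - 1 / (of_int (zorder h \<alpha>) * \<alpha>)"
  using modified_newton_at_zero[OF assms] multiplier_sphere_map[OF modified_newton_meromorphic] by simp

end

text \<open>The norm is the ratio of the distances of \<open>w\<close> from \<open>1\<close> and
  from \<open>0\<close>, and the line \<open>Re w = 1 / 2\<close> is the perpendicular bisector of
  these two points.\<close>

lemma norm_one_minus_inverse_iff:
  fixes w :: complex
  assumes "w \<noteq> 0"
  shows "norm (1 - 1 / w) < 1 \<longleftrightarrow> Re w > 1 / 2" "norm (1 - 1 / w) = 1 \<longleftrightarrow> Re w = 1 / 2"
proof -
  have "1 - 1 / w = (w - 1) / w" using assms by (simp add: field_simps)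
  hence n: "norm (1 - 1 / w) = norm (w - 1) / norm w" by (simp add: norm_divide)
  have sq: "(norm (w - 1))\<^sup>2 = (norm w)\<^sup>2 - 2 * Re w + 1"
    unfolding cmod_power2 by (simp add: power2_eq_square algebra_simps)
  have "norm (1 - 1 / w) < 1 \<longleftrightarrow> norm (w - 1) < norm w" using assms by (simp add: n)
  also have "\<dots> \<longleftrightarrow> (norm (w - 1))\<^sup>2 < (norm w)\<^sup>2" by (meson norm_ge_zero power2_less_imp_less power_strict_mono zero_less_numeral)
  also have "\<dots> \<longleftrightarrow> Re w > 1 / 2" unfolding sq by auto
  finally show "norm (1 - 1 / w) < 1 \<longleftrightarrow> Re w > 1 / 2" .
  have "norm (1 - 1 / w) = 1 \<longleftrightarrow> norm (w - 1) = norm w" using assms by (auto simp: n)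
  also have "\<dots> \<longleftrightarrow> (norm (w - 1))\<^sup>2 = (norm w)\<^sup>2" by simp
  also have "\<dots> \<longleftrightarrow> Re w = 1 / 2" unfolding sq by auto
  finally show "norm (1 - 1 / w) = 1 \<longleftrightarrow> Re w = 1 / 2" .
qed

section \<open>Newton maps of the xi function\<close>

lemma xi_symmetric: "xi (1 - s) = xi s"
  by (simp add: xi_eq_riemann_xi riemann_xi_symmetric)

lemma xi_holomorphic: "xi holomorphic_on A"
  by (simp add: xi_eq_riemann_xi holomorphic_riemann_xi)

lemma xi_0_nonzero: "xi 0 \<noteq> 0"
  by (simp add: xi_eq_riemann_xi riemann_xi_0)

text \<open>Substituting \<open>1 - w\<close> in the local factorisation at \<open>s\<close> gives
  one at \<open>1 - s\<close>; the reflection only contributes the unit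
  \<open>(-1) ^ m\<close>.\<close>

lemma zorder_xi_reflect: "zorder xi (1 - s) = zorder xi s"
proof -
  define m where "m = zorder xi s"
  define g where "g = zor_poly xi s"
  have "\<exists>w\<in>UNIV. xi w \<noteq> 0" using xi_0_nonzero by blast
  from zorder_exist_zero[OF xi_holomorphic open_UNIV connected_UNIV UNIV_I[of s] this]
  obtain r where m: "m \<ge> 0" and r: "r > 0" "g holomorphic_on cball s r"
      "\<And>w. w \<in> cball s r \<Longrightarrow> xi w = g w * (w - s) ^ nat m \<and> g w \<noteq> 0"
    unfolding m_def g_def by (metis order.refl order_less_imp_le)
  have "zorder xi (1 - s) = m"
  proof (rule zorder_eqI[where S = "ball (1 - s) r" and g = "\<lambda>w. g (1 - w) * (-1) ^ nat m"])
    have refl: "1 - w \<in> ball s r" if "w \<in> ball (1 - s) r" for w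
    proof -
      have "s - (1 - w) = - (1 - s - w)" by simp
      thus ?thesis using that by (simp only: mem_ball dist_norm norm_minus_cancel)
    qed
    have "(g \<circ> (\<lambda>w. 1 - w)) holomorphic_on ball (1 - s) r"
    proof (rule holomorphic_on_compose_gen[where t = "ball s r"])
      show "g holomorphic_on ball s r" using r(2) by (rule holomorphic_on_subset) auto
    qed (use refl in \<open>auto intro!: holomorphic_intros\<close>)
    thus "(\<lambda>w. g (1 - w) * (-1) ^ nat m) holomorphic_on ball (1 - s) r"
      by (intro holomorphic_intros) (simp add: o_def)
    show "g (1 - (1 - s)) * (-1) ^ nat m \<noteq> 0" using r by simp
    fix w assume w: "w \<in> ball (1 - s) r"
    have "1 - w \<in> cball s r" using refl[OF w] ball_subset_cball by blast
    hence "xi w = g (1 - w) * (1 - w - s) ^ nat m"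
      using r(3)[of "1 - w"] xi_symmetric[of w] by simp
    also have "1 - w - s = (- 1) * (w - (1 - s))" by simp
    also have "(\<dots>) ^ nat m = (- 1) ^ nat m * (w - (1 - s)) ^ nat m" by (rule power_mult_distrib)
    also have "(w - (1 - s)) ^ nat m = (w - (1 - s)) powi m" using m by (simp add: power_int_def)
    finally show "xi w = g (1 - w) * (-1) ^ nat m * (w - (1 - s)) powi m" by (simp only: mult.assoc)
  qed (use r in auto)
  thus ?thesis by (simp add: m_def)
qed

lemma nu_xi_eq: "nu_xi = sphere_map (modified_newton xi)"
  by (simp add: nu_xi_def modified_newton_def [abs_def])

theorem theorem11:
  defines "a \<equiv> Riemann_hypothesis \<and> (\<forall>s \<in> zeta_zeros. zorder zeta s = 1)"
      and "b \<equiv> \<forall>\<alpha>. fixed_point nu_xi \<alpha> \<longrightarrow> indifferent nu_xi \<alpha>"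
      and "c \<equiv> \<not> (\<exists>\<alpha>. attracting nu_xi \<alpha>)"
      and "d \<equiv> \<not> (\<exists>D. topological_disk D \<and> riemann_sphere closure_of (nu_xi ` D) \<subseteq> Some ` D)"
  shows "(a \<longleftrightarrow> b) \<and> (b \<longleftrightarrow> c) \<and> (c \<longleftrightarrow> d)"
proof -
  have nonconst: "\<exists>z. xi z \<noteq> c" for c using xi_not_constant by blast
  note xi = xi_holomorphic[of UNIV] xi_0_nonzero nonconst
  note fp = fixed_point_modified_newton_iff[OF xi, folded nu_xi_eq]
  have m_pos: "zorder xi \<alpha> > 0" if "xi \<alpha> = 0" for \<alpha>
    by (rule modified_newton_at_zero(1)[OF xi that])
  have mult: "norm (multiplier nu_xi \<alpha>) < 1 \<longleftrightarrow> of_int (zorder xi \<alpha>) * Re \<alpha> > 1 / 2"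
             "norm (multiplier nu_xi \<alpha>) = 1 \<longleftrightarrow> of_int (zorder xi \<alpha>) * Re \<alpha> = 1 / 2"
    if "xi \<alpha> = 0" for \<alpha>
  proof -
    have "of_int (zorder xi \<alpha>) * \<alpha> \<noteq> 0" using m_pos[OF that] that xi_0_nonzero by auto
    from norm_one_minus_inverse_iff[OF this]
    show "norm (multiplier nu_xi \<alpha>) < 1 \<longleftrightarrow> of_int (zorder xi \<alpha>) * Re \<alpha> > 1 / 2"
             "norm (multiplier nu_xi \<alpha>) = 1 \<longleftrightarrow> of_int (zorder xi \<alpha>) * Re \<alpha> = 1 / 2"
      by (simp_all add: nu_xi_eq multiplier_modified_newton[OF xi that])
  qed
  \<comment> \<open>The trivial zeros impose nothing: the Riemann hypothesis exempts them, and they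
    are simple.\<close>
  have a: "a \<longleftrightarrow> (\<forall>\<alpha>. xi \<alpha> = 0 \<longrightarrow> Re \<alpha> = 1 / 2 \<and> zorder xi \<alpha> = 1)"
    unfolding a_def Riemann_hypothesis_def zeta_zeros_eq
    using zorder_zeta_trivial_zero zorder_zeta_eq_zorder_xi xi_trivial_zero_nonzero by auto
  have b: "b \<longleftrightarrow> (\<forall>\<alpha>. xi \<alpha> = 0 \<longrightarrow> of_int (zorder xi \<alpha>) * Re \<alpha> = 1 / 2)"
    unfolding b_def indifferent_def fp using mult(2) by auto
  have c: "c \<longleftrightarrow> (\<forall>\<alpha>. xi \<alpha> = 0 \<longrightarrow> of_int (zorder xi \<alpha>) * Re \<alpha> \<le> 1 / 2)"
  proof -
    have "c \<longleftrightarrow> (\<forall>\<alpha>. xi \<alpha> = 0 \<longrightarrow> \<not> norm (multiplier nu_xi \<alpha>) < 1)"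
      unfolding c_def attracting_def fp by blast
    also have "\<dots> \<longleftrightarrow> (\<forall>\<alpha>. xi \<alpha> = 0 \<longrightarrow> of_int (zorder xi \<alpha>) * Re \<alpha> \<le> 1 / 2)"
      by (intro all_cong1 imp_cong refl) (simp only: mult(1) not_less)
    finally show ?thesis .
  qed
  have "a \<Longrightarrow> b" unfolding a b by auto
  moreover have "b \<Longrightarrow> c" unfolding b c by auto
  moreover have "a" if "c"
    unfolding a
  proof (intro allI impI)
    fix \<alpha> assume \<alpha>: "xi \<alpha> = 0"
    define m where "m = zorder xi \<alpha>"
    have "of_int m * Re \<alpha> \<le> 1 / 2" "of_int m * Re (1 - \<alpha>) \<le> 1 / 2"
      using \<open>c\<close> \<alpha> unfolding c m_def by (simp, metis xi_symmetric zorder_xi_reflect)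
    moreover from this have "of_int m \<le> (1::real)" by (simp add: algebra_simps)
    \<comment> \<open>With \<open>m = 1\<close> the two inequalities read
      \<open>Re \<alpha> \<le> 1 / 2\<close> and \<open>1 - Re \<alpha> \<le> 1 / 2\<close>, which
      forces equality.\<close>
    hence "m = 1" using m_pos[OF \<alpha>] by (simp add: m_def)
    ultimately show "Re \<alpha> = 1 / 2 \<and> zorder xi \<alpha> = 1" by (simp add: m_def)
  qed
  moreover have "c \<longleftrightarrow> d"
  proof -
    note mero = modified_newton_meromorphic[OF xi]
    have "is_pole (modified_newton xi) 0"
      by (rule modified_newton_pole[OF xi]) (use xi_0_nonzero in auto)
    thus ?thesis
      unfolding c_def d_def nu_xi_eq
      using attracting_imp_absorbing_disk[OF mero] absorbing_disk_imp_attracting[OF mero] by blast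
  qed
  ultimately show ?thesis by blast
qed

end
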